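(* Let $n\ge5$ and $S=\{1,s\}\subset\mathbb Z_n$ with $s$ an integer, $1<s<n/2$, and let $\mathbb K$ be a field of characteristic $0$. (1) If $s=2$, then $H_0^{\mathrm{path}}(\vec C_n^S;\mathbb K)\cong\mathbb K$, $H_1^{\mathrm{path}}(\vec C_n^S;\mathbb K)\cong\mathbb K$, and $H_m^{\mathrm{path}}(\vec C_n^S;\mathbb K)=0$ for $m\ge2$. (2) If $s\ne2$, then $H_0^{\mathrm{path}}\cong\mathbb K$, $H_1^{\mathrm{path}}\cong\mathbb K^2$, $H_2^{\mathrm{path}}\cong\mathbb K$, and $H_m^{\mathrm{path}}=0$ for $m\ge3$.
   Context: GLMY path complex over a field $\mathbb K$ of characteristic $0$: elementary paths $e_{v_0\cdots v_n}$, boundary $\partial e_{v_0\cdots v_n}=\sum_{j}(-1)^j e_{v_0\cdots\widehat{v_j}\cdots v_n}$, paths with two equal consecutive vertices set to $0$; $A_n(G)$ = span of paths along arrows of $G$; $\Omega_0=A_0$, $\Omega_1=A_1$, $\Omega_n=\{u\in A_n:\partial u\in A_{n-1}\}$; $H^{\mathrm{path}}_m$ is the homology of $(\Omega_*,\partial)$. The circulant digraph $\vec{C}_n^S$ has vertex set $\mathbb Z_n$ and an arrow $a\to a+s$ for each $a\in\mathbb Z_n$, $s\in S$. *)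

theory Defs
  imports Complex_Main "HOL-Library.Function_Algebras"
begin

definition circ_arrow :: "nat \<Rightarrow> nat set \<Rightarrow> nat \<Rightarrow> nat \<Rightarrow> bool" where
  "circ_arrow n S a b \<longleftrightarrow> a < n \<and> b < n \<and> (\<exists>s\<in>S. b = (a + s) mod n)"

definition allowed_path :: "nat \<Rightarrow> nat set \<Rightarrow> nat list \<Rightarrow> bool" where
  "allowed_path n S p \<longleftrightarrow> (\<forall>v\<in>set p. v < n) \<and>
     (\<forall>i. Suc i < length p \<longrightarrow> circ_arrow n S (p ! i) (p ! Suc i))"

definition regular_path :: "nat list \<Rightarrow> bool" where
  "regular_path p \<longleftrightarrow> (\<forall>i. Suc i < length p \<longrightarrow> p ! i \<noteq> p ! Suc i)"

(* chains: coefficient functions on elementary paths (vertex lists) *)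
type_synonym 'k chain = "nat list \<Rightarrow> 'k"

definition del_at :: "nat \<Rightarrow> 'a list \<Rightarrow> 'a list" where
  "del_at j p = take j p @ drop (Suc j) p"

(* boundary: d e_{v0..vm} = sum_j (-1)^j e_{v0..^vj..vm}, non-regular paths set to 0;
   the boundary of a 0-path is 0 (non-augmented complex).  Extended linearly over the
   (finite) support of the chain. *)
definition path_bd :: "'k::field chain \<Rightarrow> 'k chain" where
  "path_bd f q = (if q = [] \<or> \<not> regular_path q then 0 else
     (\<Sum>p\<in>{p. f p \<noteq> 0}. \<Sum>j<length p. if del_at j p = q then (-1) ^ j * f p else 0))"

definition A_space :: "nat \<Rightarrow> nat set \<Rightarrow> nat \<Rightarrow> 'k::field chain set" where
  "A_space n S m = {f. \<forall>p. f p \<noteq> 0 \<longrightarrow> length p = Suc m \<and> allowed_path n S p}"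

definition Omega_space :: "nat \<Rightarrow> nat set \<Rightarrow> nat \<Rightarrow> 'k::field chain set" where
  "Omega_space n S m = (if m \<le> 1 then A_space n S m
      else {u \<in> A_space n S m. path_bd u \<in> A_space n S (m - 1)})"

definition cycles :: "nat \<Rightarrow> nat set \<Rightarrow> nat \<Rightarrow> 'k::field chain set" where
  "cycles n S m = {u \<in> Omega_space n S m. path_bd u = (\<lambda>_. 0)}"

definition boundaries :: "nat \<Rightarrow> nat set \<Rightarrow> nat \<Rightarrow> 'k::field chain set" where
  "boundaries n S m = path_bd ` Omega_space n S (Suc m)"

abbreviation chain_scale :: "'k::field \<Rightarrow> 'k chain \<Rightarrow> 'k chain" where
  "chain_scale c f \<equiv> (\<lambda>x. c * f x)"

(* H_m^path(C_n^S; K) \<cong> K^d, expressed via dimensions of the (finite-dimensional)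
   cycle and boundary spaces: dim Z_m = dim B_m + d *)
definition path_homology_dim :: "'k::field itself \<Rightarrow> nat \<Rightarrow> nat set \<Rightarrow> nat \<Rightarrow> nat \<Rightarrow> bool" where
  "path_homology_dim _ n S m d \<longleftrightarrow>
     vector_space.dim chain_scale (cycles n S m :: 'k chain set)
       = vector_space.dim chain_scale (boundaries n S m :: 'k chain set) + d"

end

theory Submission
  imports Defs
begin

text \<open>
  Since \<open>2 * s < n\<close>, the sums \<open>2\<close>, \<open>1 + s\<close>, \<open>2 * s\<close> of two steps are distinct and nonzero modulo \<open>n\<close>,
  and the last two are never arrows. Writing a path as a start vertex with a word in the steps
  \<open>1\<close> and \<open>s\<close>, membership in \<open>\<Omega>\<close> means that a chain vanishes on words containing \<open>s s\<close>
  (and \<open>1 1\<close>, if \<open>s \<noteq> 2\<close>) and changes sign when adjacent letters \<open>1\<close> and \<open>s\<close> are swapped.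

  If \<open>s \<noteq> 2\<close>, this kills \<open>\<Omega>\<close> in degrees above 2, and the squares \<open>1 s - s 1\<close> span degree 2: the
  complex is that of a torus. If \<open>s = 2\<close>, a chain of degree \<open>m \<ge> 1\<close> is determined by its values
  \<open>P\<close> on \<open>1\<^sup>m\<close> and \<open>Q\<close> on \<open>s 1\<^sup>m\<^sup>-\<^sup>1\<close>, and the cycle condition expresses \<open>P\<close> through \<open>Q\<close> in exactly the
  way that makes the chain, for \<open>m \<ge> 2\<close>, the boundary of the chain with coordinates \<open>(- Q, 0)\<close>.
\<close>

section \<open>Linear algebra for comparing dimensions of spans of chains\<close>

interpretation chains: vector_space "chain_scale :: 'k::field \<Rightarrow> 'k chain \<Rightarrow> 'k chain"
  by unfold_locales (auto simp: algebra_simps fun_eq_iff)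

text \<open>The finite spanning set \<open>F\<close> forces a basis of \<open>B\<close> to be
  finite; for an infinite one \<open>card\<close> would be 0 and adjoining \<open>v\<close> would
  not raise it.\<close>

lemma dim_insert_chain:
  fixes B :: "'k::field chain set"
  assumes "finite F" "B \<subseteq> chains.span F" "v \<notin> chains.span B"
  shows "chains.dim (insert v B) = chains.dim B + 1"
proof -
  obtain b where b: "b \<subseteq> B" "chains.independent b" "B \<subseteq> chains.span b" "card b = chains.dim B"
    using chains.basis_exists by blast
  have fin: "finite b"
    using chains.independent_span_bound[OF assms(1) b(2)] b(1) assms(2) by blast
  have sp: "chains.span b = chains.span B"
    using chains.span_mono[OF b(1)] chains.span_minimal[OF b(3) chains.subspace_span] by blast
  have "v \<notin> b" using sp assms(3) chains.span_base by blast
  moreover have "chains.independent (insert v b)"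
    by (rule chains.independent_insertI) (use b(2) assms(3) sp in auto)
  moreover have "insert v B \<subseteq> chains.span (insert v b)"
    using b(3) chains.span_mono[of b "insert v b"] chains.span_base by blast
  ultimately show ?thesis
    using fin b(1,4) chains.dim_unique[of "insert v b" "insert v B" "chains.dim B + 1"] by auto
qed

lemma dim_eq_if_spans:
  fixes Z :: "'k::field chain set"
  assumes "X \<subseteq> Z" "Z \<subseteq> chains.span X"
  shows "chains.dim Z = chains.dim X"
proof (rule chains.span_eq_dim)
  show "chains.span Z = chains.span X"
    using chains.span_mono[OF assms(1)] chains.span_minimal[OF assms(2) chains.subspace_span] by blast
qed

text \<open>The kernel of a linear functional is a subspace, so it contains the span of
  \<open>B\<close>. This is how a cycle is shown not to be a boundary.\<close>

lemma not_in_span_if_functional: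
  fixes v :: "'k::field chain" and f :: "'k chain \<Rightarrow> 'k"
  assumes "\<And>x y. f (x + y) = f x + f y" "\<And>c x. f (chain_scale c x) = c * f x"
    "\<And>x. x \<in> B \<Longrightarrow> f x = 0" "f v \<noteq> 0"
  shows "v \<notin> chains.span B"
proof -
  have "f 0 = 0" using assms(2)[of 0 0] by (simp add: zero_fun_def)
  then have "chains.subspace {x. f x = 0}"
    unfolding chains.subspace_def using assms(1,2) by simp
  then have "chains.span B \<subseteq> {x. f x = 0}"
    using assms(3) by (intro chains.span_minimal) auto
  then show ?thesis using assms(4) by blast
qed

section \<open>The boundary as a signed sum over vertex insertions\<close>

text \<open>
  The boundary written dually, as a sum over vertex insertions: \<open>(-1)\<^sup>j\<close> is the sign of inserting at
  position \<open>j\<close>, and on chains of allowed paths no regularity condition is needed.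
\<close>

fun ins_bd :: "nat \<Rightarrow> 'k::field chain \<Rightarrow> 'k chain" where
  "ins_bd n u [] = (\<Sum>v<n. u [v])"
| "ins_bd n u (x # q) = (\<Sum>v<n. u (v # x # q)) - ins_bd n (\<lambda>r. u (x # r)) q"

lemma ins_bd_diff: "ins_bd n (\<lambda>p. u p - u' p) q = ins_bd n u q - ins_bd n u' q"
  by (induction q arbitrary: u u') (simp_all add: sum_subtractf)

lemma ins_bd_sum: "ins_bd n (\<lambda>p. \<Sum>v<k::nat. u v p) q = (\<Sum>v<k. ins_bd n (u v) q)"
proof (induction q arbitrary: u)
  case Nil
  show ?case unfolding ins_bd.simps by (rule sum.swap)
next
  case (Cons x q)
  have "(\<Sum>v<n. \<Sum>w<k. u w (v # x # q)) = (\<Sum>w<k. \<Sum>v<n. u w (v # x # q))"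
    by (rule sum.swap)
  then show ?case by (simp add: Cons.IH sum_subtractf)
qed

lemma ins_bd_zero: "ins_bd n (\<lambda>p. 0) q = 0"
  by (induction q) simp_all

text \<open>Two insertions before \<open>x\<close> cancel by exchanging the new vertices, one before
  and one after \<open>x\<close> occurs twice with opposite signs, and two after \<open>x\<close>
  are covered by induction.\<close>

lemma ins_bd_ins_bd: "ins_bd n (ins_bd n u) q = 0"
proof (induction q arbitrary: u)
  case Nil
  have "(\<Sum>v<n. \<Sum>w<n. u [w, v]) = (\<Sum>v<n. \<Sum>w<n. u [v, w])"
    by (rule sum.swap)
  then show ?case by (simp add: sum_subtractf)
next
  case (Cons x q)
  have "(\<Sum>v<n. \<Sum>w<n. u (w # v # x # q)) = (\<Sum>v<n. \<Sum>w<n. u (v # w # x # q))"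
    by (rule sum.swap)
  then show ?case
    using Cons.IH[of "\<lambda>r. u (x # r)"]
    by (simp add: sum_subtractf ins_bd_diff ins_bd_sum)
qed

lemma ins_bd_eq_sum:
  "ins_bd n u q = (\<Sum>j\<le>length q. (-1) ^ j * (\<Sum>v<n. u (take j q @ v # drop j q)))"
proof (induction q arbitrary: u)
  case (Cons x q)
  show ?case
    by (simp add: Cons.IH sum.atMost_Suc_shift sum_negf del: sum.atMost_Suc)
qed simp

text \<open>Double counting: deleting position \<open>j\<close> of \<open>p\<close> leaves
  \<open>q\<close> exactly when \<open>p\<close> arises from \<open>q\<close> by inserting
  \<open>p ! j\<close> at position \<open>j\<close>.\<close>

lemma path_bd_eq_ins_bd:
  fixes u :: "'k::field chain"
  assumes "finite {p. u p \<noteq> 0}" "\<And>p. u p \<noteq> 0 \<Longrightarrow> set p \<subseteq> {..<n}" "q \<noteq> []" "regular_path q"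
  shows "path_bd u q = ins_bd n u q"
proof -
  let ?U = "{p. u p \<noteq> 0}"
  let ?L = "{(p, j). p \<in> ?U \<and> j < length p \<and> del_at j p = q}"
  let ?R = "{..length q} \<times> {..<n}"
  have fin: "finite (Sigma ?U (\<lambda>p. {..<length p}))" using assms(1) by blast
  have finL: "finite ?L" by (rule finite_subset[OF _ fin]) auto
  have "path_bd u q = (\<Sum>(p, j)\<in>Sigma ?U (\<lambda>p. {..<length p}). if del_at j p = q then (-1) ^ j * u p else 0)"
    using assms by (simp add: path_bd_def sum.Sigma)
  also have "\<dots> = (\<Sum>(p, j)\<in>?L. (-1) ^ j * u p)"
    by (rule sum.mono_neutral_cong_right[OF fin]) (auto split: if_splits)
  also have "\<dots> = (\<Sum>(j, v)\<in>?R. (-1) ^ j * u (take j q @ v # drop j q))"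
  \<comment> \<open>The set \<open>T'\<close> discards the insertions that leave the support of
    \<open>u\<close>; they have no partner on the deletion side.\<close>
  proof (rule sum.reindex_bij_witness_not_neutral[where
        S' = "{}" and T' = "{(j, v)\<in>?R. u (take j q @ v # drop j q) = 0}" and
        i = "\<lambda>(j, v). (take j q @ v # drop j q, j)" and j = "\<lambda>(p, j). (j, p ! j)"])
    have id: "take j q @ p ! j # drop j q = p" if "j < length p" "del_at j p = q" for p j
      using that by (auto simp: del_at_def id_take_nth_drop[symmetric])
    have len: "j \<le> length q" if "j < length p" "del_at j p = q" for p :: "nat list" and j
      using that by (auto simp: del_at_def)
    have del: "del_at j (take j q @ v # drop j q) = q" if "j \<le> length q" for j v
      using that by (simp add: del_at_def)
    show "finite {(j, v)\<in>?R. u (take j q @ v # drop j q) = 0}"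
      by (rule finite_subset[of _ ?R]) auto
    show "(\<lambda>(j, v). (take j q @ v # drop j q, j)) ((\<lambda>(p, j). (j, p ! j)) a) = a"
      if "a \<in> ?L - {}" for a
      using that id by auto
    show "(\<lambda>(p, j). (j, p ! j)) a \<in> ?R - {(j, v)\<in>?R. u (take j q @ v # drop j q) = 0}"
      if "a \<in> ?L - {}" for a
      using that id len assms(2) nth_mem by fastforce
    show "(\<lambda>(p, j). (j, p ! j)) ((\<lambda>(j, v). (take j q @ v # drop j q, j)) b) = b"
      if "b \<in> ?R - {(j, v)\<in>?R. u (take j q @ v # drop j q) = 0}" for b
      using that by (auto simp: nth_append)
    show "(\<lambda>(j, v). (take j q @ v # drop j q, j)) b \<in> ?L - {}"
      if "b \<in> ?R - {(j, v)\<in>?R. u (take j q @ v # drop j q) = 0}" for b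
      using that del by auto
    show "(case (\<lambda>(p, j). (j, p ! j)) a of (j, v) \<Rightarrow> (-1) ^ j * u (take j q @ v # drop j q)) =
        (case a of (p, j) \<Rightarrow> (-1) ^ j * u p)"
      if "a \<in> ?L" for a
      using that id by auto
  qed (auto simp: finL)
  also have "\<dots> = ins_bd n u q"
    by (simp add: ins_bd_eq_sum sum.cartesian_product[symmetric] sum_distrib_left)
  finally show ?thesis .
qed


text \<open>An insertion anywhere except between \<open>x\<close> and \<open>y\<close> keeps the
  edge from \<open>x\<close> to \<open>y\<close>, where \<open>u\<close> vanishes, so a single
  position survives.\<close>

lemma ins_bd_at_vanishing_edge:
  assumes "\<And>r1 r2. u (r1 @ x # y # r2) = 0"
  shows "ins_bd n u (q1 @ x # y # q2) = (-1) ^ Suc (length q1) * (\<Sum>v<n. u (q1 @ x # v # y # q2))"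
  using assms
proof (induction q1 arbitrary: u)
  case Nil
  show ?case
    using Nil[of "[]"] Nil[of "[_]"] by (simp add: ins_bd_zero)
next
  case (Cons z q1)
  have "u (v # z # q1 @ x # y # q2) = 0" for v
    using Cons.prems[of "v # z # q1"] by simp
  moreover have "u (z # r1 @ x # y # r2) = 0" for r1 r2
    using Cons.prems[of "z # r1"] by simp
  ultimately show ?case
    using Cons.IH[of "\<lambda>r. u (z # r)"] by simp
qed

lemma sum_eq_two_terms:
  fixes f :: "nat \<Rightarrow> 'a::comm_monoid_add"
  assumes "x < n" "y < n" "x \<noteq> y" "\<And>v. v \<noteq> x \<Longrightarrow> v \<noteq> y \<Longrightarrow> f v = 0"
  shows "(\<Sum>v<n. f v) = f x + f y"
proof -
  have "(\<Sum>v<n. f v) = (\<Sum>v\<in>{x, y}. f v)"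
    by (rule sum.mono_neutral_right) (use assms in auto)
  then show ?thesis using assms(3) by simp
qed

section \<open>Vertices and arrows of the circulant digraph\<close>

locale circulant =
  fixes n s :: nat
  assumes n_ge: "5 \<le> n" and s_gt: "1 < s" and s_lt: "2 * s < n"
begin

definition S :: "nat set" where
  "S = {1, s}"

abbreviation "arr \<equiv> circ_arrow n S"
abbreviation "A \<equiv> A_space n S"
abbreviation "\<Omega> \<equiv> Omega_space n S"

text \<open>Vertices are named by arbitrary integers, so that backward steps such as
  \<open>a - 1\<close> and \<open>a - int s\<close> avoid truncated subtraction.\<close>

definition vtx :: "int \<Rightarrow> nat" where
  "vtx a = nat (a mod int n)"

lemma n_pos: "int n > 0" using n_ge by simp

lemma vtx_less: "vtx a < n"
  using n_pos by (simp add: vtx_def nat_less_iff)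

lemma vtx_eq_iff: "vtx a = vtx b \<longleftrightarrow> int n dvd a - b"
proof -
  have "vtx a = vtx b \<longleftrightarrow> a mod int n = b mod int n"
    using n_pos by (simp add: vtx_def nat_eq_iff)
  then show ?thesis by (simp add: mod_eq_dvd_iff)
qed

lemma vtx_int: "x < n \<Longrightarrow> vtx (int x) = x"
  by (simp add: vtx_def)

lemma vtx_mod [simp]: "vtx (a mod int n) = vtx a"
  by (simp add: vtx_def)

lemma int_vtx: "int (vtx a) = a mod int n"
  using n_pos by (simp add: vtx_def)

lemma vtx_add_nat: "(vtx a + t) mod n = vtx (a + int t)"
proof -
  have "int ((vtx a + t) mod n) = int (vtx (a + int t))"
    by (simp add: int_vtx zmod_int mod_simps)
  then show ?thesis by linarith
qed

text \<open>This is where \<open>2 * s < n\<close> takes effect: differences among 0, 1,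
  \<open>s\<close>, 2, \<open>1 + s\<close> and \<open>2 * s\<close> stay below \<open>n\<close> in
  absolute value, so distinct ones are incongruent.\<close>

lemma not_dvd_small: "d \<noteq> 0 \<Longrightarrow> \<bar>d\<bar> < int n \<Longrightarrow> \<not> int n dvd d"
  using dvd_imp_le_int[of d "int n"] by auto

lemma arr_vtx: "arr (vtx a) y \<longleftrightarrow> y = vtx (a + 1) \<or> y = vtx (a + int s)"
  using vtx_add_nat[of a 1] vtx_add_nat[of a s] vtx_less by (auto simp: circ_arrow_def S_def)

lemma arr_vtx_vtx: "arr (vtx a) (vtx b) \<longleftrightarrow> int n dvd b - a - 1 \<or> int n dvd b - a - int s"
  by (simp add: arr_vtx vtx_eq_iff diff_diff_eq)

lemma arr_to_vtx:
  assumes "arr x (vtx b)"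
  shows "x = vtx (b - 1) \<or> x = vtx (b - int s)"
proof -
  have x: "x = vtx (int x)" using assms by (simp add: circ_arrow_def vtx_int)
  then have "int n dvd b - int x - 1 \<or> int n dvd b - int x - int s"
    using assms arr_vtx_vtx by metis
  then have "vtx (b - 1) = vtx (int x) \<or> vtx (b - int s) = vtx (int x)"
    by (simp add: vtx_eq_iff algebra_simps)
  then show ?thesis using x by metis
qed

lemma vtx_steps_distinct: "vtx (a + 1) \<noteq> vtx (a + int s)" "vtx (a - 1) \<noteq> vtx (a - int s)"
  using not_dvd_small[of "1 - int s"] not_dvd_small[of "int s - 1"] s_gt s_lt
  by (auto simp: vtx_eq_iff)

lemma allowed_path_edge: "allowed_path n S (r1 @ x # y # r2) \<Longrightarrow> arr x y"
  unfolding allowed_path_def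
  by (drule conjunct2, drule spec[of _ "length r1"]) (simp add: nth_append)

lemma A_edge: "u \<in> A m \<Longrightarrow> \<not> arr x y \<Longrightarrow> u (r1 @ x # y # r2) = 0"
  using allowed_path_edge[of r1 x y r2] by (auto simp: A_space_def)

lemma not_allowedE:
  assumes "\<not> allowed_path n S p" "set p \<subseteq> {..<n}"
  obtains r1 x y r2 where "p = r1 @ x # y # r2" "\<not> arr x y" "x < n" "y < n"
proof -
  obtain i where i: "Suc i < length p" "\<not> arr (p ! i) (p ! Suc i)"
    using assms unfolding allowed_path_def by auto
  have "p = take i p @ p ! i # p ! Suc i # drop (Suc (Suc i)) p"
    using i(1) by (simp add: Cons_nth_drop_Suc)
  then show thesis
    using that i assms(2) by (metis Suc_lessD lessThan_iff nth_mem subsetD)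
qed

lemma A_length: "u \<in> A m \<Longrightarrow> u p \<noteq> 0 \<Longrightarrow> length p = Suc m"
  by (auto simp: A_space_def)

lemma A_vertices: "u \<in> A m \<Longrightarrow> u p \<noteq> 0 \<Longrightarrow> set p \<subseteq> {..<n}"
  by (auto simp: A_space_def allowed_path_def)

lemma A_finite:
  assumes "u \<in> A m"
  shows "finite {p. u p \<noteq> 0}"
  by (rule finite_subset[OF _ finite_lists_length_eq[of "{..<n}" "Suc m"]])
    (use A_length[OF assms] A_vertices[OF assms] in \<open>simp_all add: subset_iff\<close>)

lemma sum_after_vtx:
  assumes "u \<in> A m"
  shows "(\<Sum>v<n. u (r1 @ vtx b # v # r2)) =
    u (r1 @ vtx b # vtx (b + 1) # r2) + u (r1 @ vtx b # vtx (b + int s) # r2)"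
proof (rule sum_eq_two_terms)
  show "u (r1 @ vtx b # v # r2) = 0" if "v \<noteq> vtx (b + 1)" "v \<noteq> vtx (b + int s)" for v
    using A_edge[OF assms, of "vtx b" v r1 r2] that by (simp add: arr_vtx)
qed (rule vtx_less vtx_steps_distinct)+

lemma sum_before_vtx:
  assumes "u \<in> A m"
  shows "(\<Sum>v<n. u (v # vtx b # r)) = u (vtx (b - 1) # vtx b # r) + u (vtx (b - int s) # vtx b # r)"
proof (rule sum_eq_two_terms)
  show "u (v # vtx b # r) = 0" if "v \<noteq> vtx (b - 1)" "v \<noteq> vtx (b - int s)" for v
    using A_edge[OF assms, of v "vtx b" "[]" r] arr_to_vtx[of v b] that by auto
qed (rule vtx_less vtx_steps_distinct)+

text \<open>The assumptions say that \<open>c\<close> is not congruent to a sum of two steps, so no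
  vertex can be inserted on the way from \<open>b\<close> to \<open>b + c\<close>.\<close>

lemma sum_between_vtx_eq_0:
  assumes "u \<in> A m" "\<not> int n dvd c - 2" "\<not> int n dvd c - 1 - int s" "\<not> int n dvd c - 2 * int s"
  shows "(\<Sum>v<n. u (r1 @ vtx b # v # vtx (b + c) # r2)) = 0"
proof -
  have "\<not> arr (vtx (b + 1)) (vtx (b + c))" "\<not> arr (vtx (b + int s)) (vtx (b + c))"
    using assms(2-4) by (simp_all add: arr_vtx_vtx algebra_simps)
  then show ?thesis
    using A_edge[OF assms(1), of _ _ "r1 @ [vtx b]" r2] by (simp add: sum_after_vtx[OF assms(1)])
qed

lemma ins_bd_at_non_arrow:
  assumes "u \<in> A m" "\<not> arr x y"
  shows "ins_bd n u (q1 @ x # y # q2) = (-1) ^ Suc (length q1) * (\<Sum>v<n. u (q1 @ x # v # y # q2))"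
  using ins_bd_at_vanishing_edge A_edge[OF assms] by blast

lemma ins_bd_nonzero:
  assumes "u \<in> A m" "ins_bd n u q \<noteq> 0"
  shows "length q = m" "set q \<subseteq> {..<n}"
proof -
  obtain j v where j: "j \<le> length q" "u (take j q @ v # drop j q) \<noteq> 0"
    using assms(2) unfolding ins_bd_eq_sum
    by (metis (no_types, lifting) atMost_iff mult_zero_right sum.neutral)
  show "length q = m" using A_length[OF assms(1) j(2)] j(1) by simp
  have "set (take j q) \<union> set (drop j q) \<subseteq> {..<n}" using A_vertices[OF assms(1) j(2)] by simp
  then show "set q \<subseteq> {..<n}" by (metis append_take_drop_id set_append)
qed

text \<open>Returning to \<open>x\<close> in two steps would make 2, \<open>1 + s\<close> or
  \<open>2 * s\<close> divisible by \<open>n\<close>. Hence the convention that non-regular paths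
  are 0 agrees with \<open>ins_bd\<close>.\<close>

lemma ins_bd_repeated_vertex:
  assumes "u \<in> A m"
  shows "ins_bd n u (q1 @ x # x # q2) = 0"
proof (cases "x < n")
  case True
  then obtain b where b: "x = vtx b" by (metis vtx_int)
  have "\<not> arr x x"
    unfolding b arr_vtx_vtx
    using not_dvd_small[of "b - b - 1"] not_dvd_small[of "b - b - int s"] s_gt s_lt by simp
  moreover have "(\<Sum>v<n. u (q1 @ vtx b # v # vtx (b + 0) # q2)) = 0"
    by (rule sum_between_vtx_eq_0[OF assms]; rule not_dvd_small) (use n_ge s_gt s_lt in auto)
  ultimately show ?thesis
    using ins_bd_at_non_arrow[OF assms] by (simp add: b)
next
  case False
  then show ?thesis using ins_bd_nonzero(2)[OF assms, of "q1 @ x # x # q2"] by auto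
qed

section \<open>The boundary on allowed chains and the local conditions defining
  \<open>\<Omega>\<close>\<close>

text \<open>Positive degree matters: in degree 0, \<open>ins_bd\<close> at the empty path is the
  augmentation, while \<open>path_bd\<close> is 0 there.\<close>

lemma path_bd_A_Suc:
  assumes "u \<in> A (Suc m)"
  shows "path_bd u = ins_bd n u"
proof
  fix q
  consider "q = []" | "q \<noteq> []" "regular_path q" | "\<not> regular_path q" by blast
  then show "path_bd u q = ins_bd n u q"
  proof cases
    case 1
    then show ?thesis
      using ins_bd_nonzero(1)[OF assms, of "[]"] by (auto simp: path_bd_def)
  next
    case 2
    then show ?thesis
      by (intro path_bd_eq_ins_bd) (use A_finite[OF assms] A_vertices[OF assms] in auto)
  next
    case 3
    then obtain i where i: "Suc i < length q" "q ! i = q ! Suc i"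
      by (auto simp: regular_path_def)
    have "q = take i q @ q ! i # q ! Suc i # drop (Suc (Suc i)) q"
      using i(1) by (simp add: Cons_nth_drop_Suc)
    then have "ins_bd n u q = 0" using ins_bd_repeated_vertex[OF assms] i(2) by metis
    then show ?thesis using 3 by (simp add: path_bd_def)
  qed
qed

lemma path_bd_A_0: "u \<in> A 0 \<Longrightarrow> path_bd u = (\<lambda>_. 0)"
proof
  fix q
  assume u: "u \<in> A 0"
  show "path_bd u q = 0"
  proof (cases "q = [] \<or> \<not> regular_path q")
    case False
    then have "path_bd u q = ins_bd n u q"
      by (intro path_bd_eq_ins_bd) (use A_finite[OF u] A_vertices[OF u] in auto)
    then show ?thesis using ins_bd_nonzero(1)[OF u, of q] False by auto
  qed (simp add: path_bd_def)
qed

lemma \<Omega>_subset_A: "u \<in> \<Omega> m \<Longrightarrow> u \<in> A m"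
  by (auto simp: Omega_space_def split: if_splits)

text \<open>The boundary has coefficient 0 on any path through the non-arrow from \<open>b\<close>
  to \<open>b + c\<close>. Only insertions into that edge contribute to this coefficient, and the
  candidates are \<open>b + 1\<close> and \<open>b + s\<close>.\<close>

lemma \<Omega>_non_arrow:
  assumes "u \<in> \<Omega> m" "\<not> int n dvd c - 1" "\<not> int n dvd c - int s"
  shows "u (r1 @ vtx b # vtx (b + 1) # vtx (b + c) # r2) +
    u (r1 @ vtx b # vtx (b + int s) # vtx (b + c) # r2) = 0"
proof (cases "m \<le> 1")
  case True
  then have "u (r1 @ x # y # z # r2) = 0" for x y z
    using A_length[OF \<Omega>_subset_A[OF assms(1)], of "r1 @ x # y # z # r2"] by fastforce
  then show ?thesis by simp
next
  case False
  define k where "k = m - 2"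
  with False have k: "m = Suc (Suc k)" by simp
  have u: "u \<in> A (Suc (Suc k))" using \<Omega>_subset_A[OF assms(1)] k by simp
  have na: "\<not> arr (vtx b) (vtx (b + c))" using assms(2,3) by (simp add: arr_vtx_vtx)
  have "ins_bd n u \<in> A (Suc k)"
    using assms(1) path_bd_A_Suc[OF u] by (simp add: Omega_space_def k)
  then have "ins_bd n u (r1 @ vtx b # vtx (b + c) # r2) = 0" using A_edge na by blast
  then show ?thesis
    using ins_bd_at_non_arrow[OF u na, of r1 r2] by (simp add: sum_after_vtx[OF u])
qed

text \<open>Converse of \<open>\<Omega>_non_arrow\<close>: a path that is not allowed contains a
  non-arrow, and the condition at that edge kills its coefficient in the boundary.\<close>

lemma \<Omega>I:
  assumes u: "u \<in> A m"
    and bad: "\<And>r1 b c r2. \<not> int n dvd c - 1 \<Longrightarrow> \<not> int n dvd c - int s \<Longrightarrow>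
      u (r1 @ vtx b # vtx (b + 1) # vtx (b + c) # r2) +
      u (r1 @ vtx b # vtx (b + int s) # vtx (b + c) # r2) = 0"
  shows "u \<in> \<Omega> m"
proof (cases "m \<le> 1")
  case False
  then obtain k where k: "m = Suc k" by (cases m) auto
  have "ins_bd n u \<in> A k"
    unfolding A_space_def mem_Collect_eq
  proof (intro allI impI conjI)
    fix q
    assume q: "ins_bd n u q \<noteq> 0"
    show "length q = Suc k" using ins_bd_nonzero(1)[OF u q] k by simp
    show "allowed_path n S q"
    proof (rule ccontr)
      assume "\<not> allowed_path n S q"
      then obtain r1 x y r2 where d: "q = r1 @ x # y # r2" "\<not> arr x y" "x < n" "y < n"
        using not_allowedE ins_bd_nonzero(2)[OF u q] by metis
      define b c where "b = int x" and "c = int y - int x"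
      have xy: "x = vtx b" "y = vtx (b + c)" using d by (simp_all add: b_def c_def vtx_int)
      have "ins_bd n u q = 0"
        using ins_bd_at_non_arrow[OF u d(2), of r1 r2] bad[of c r1 b r2] d(2)
        by (simp add: d(1) xy sum_after_vtx[OF u] arr_vtx_vtx)
      then show False using q by simp
    qed
  qed
  then show ?thesis
    using False u path_bd_A_Suc[of u k] by (simp add: Omega_space_def k)
qed (use u in \<open>simp add: Omega_space_def\<close>)

lemma zero_in_A: "(\<lambda>_. 0) \<in> A m"
  by (simp add: A_space_def)

lemma path_bd_\<Omega>:
  assumes "u \<in> \<Omega> (Suc m)"
  shows "path_bd u \<in> \<Omega> m" "path_bd (path_bd u) = (\<lambda>_. 0)"
proof -
  have u: "u \<in> A (Suc m)" using assms \<Omega>_subset_A by blast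
  have A: "path_bd u \<in> A m"
  proof (cases m)
    case 0
    then show ?thesis
      using ins_bd_nonzero[OF u] unfolding path_bd_A_Suc[OF u]
      by (auto simp: A_space_def allowed_path_def)
  next
    case (Suc k)
    then show ?thesis using assms by (simp add: Omega_space_def)
  qed
  show dd: "path_bd (path_bd u) = (\<lambda>_. 0)"
  proof (cases m)
    case 0
    then show ?thesis using A path_bd_A_0 by simp
  next
    case (Suc k)
    then have "path_bd (path_bd u) = ins_bd n (ins_bd n u)"
      using A path_bd_A_Suc u by metis
    then show ?thesis using ins_bd_ins_bd by (metis ext)
  qed
  \<comment> \<open>Being a cycle, \<open>path_bd u\<close> has boundary 0, which is trivially
    allowed.\<close>
  show "path_bd u \<in> \<Omega> m"
    using A dd by (simp add: Omega_space_def zero_in_A)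
qed

lemma boundaries_subset_cycles: "boundaries n S m \<subseteq> cycles n S m"
  using path_bd_\<Omega> by (auto simp: boundaries_def cycles_def)


section \<open>Paths as a start vertex and a word of steps\<close>

text \<open>Steps may be any integers, so that paths through non-arrows can be named as well;
  \<open>words\<close> restricts to genuine arrow steps.\<close>

fun walk :: "int \<Rightarrow> int list \<Rightarrow> nat list" where
  "walk a [] = [vtx a]"
| "walk a (t # w) = vtx a # walk (a + t) w"

definition words :: "nat \<Rightarrow> int list set" where
  "words m = {w. length w = m \<and> set w \<subseteq> {1, int s}}"

lemma length_walk [simp]: "length (walk a w) = Suc (length w)"
  by (induction w arbitrary: a) simp_all

lemma walk_hd: "\<exists>r. walk a w = vtx a # r"
  by (cases w) simp_all

lemma hd_walk [simp]: "hd (walk a w) = vtx a"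
  by (cases w) simp_all

lemma walk_last: "\<exists>r. walk a w = r @ [vtx (a + sum_list w)]"
  by (induction w arbitrary: a) (simp, metis append_Cons sum_list.Cons add.assoc walk.simps(2))

lemma walk_append: "walk a (w1 @ t # w2) = walk a w1 @ walk (a + sum_list w1 + t) w2"
  by (induction w1 arbitrary: a) (simp_all add: add.assoc)

lemma walk_cong:
  assumes "int n dvd a - b"
  shows "walk a w = walk b w"
  using assms
proof (induction w arbitrary: a b)
  case (Cons t w)
  then show ?case using Cons.IH[of "a + t" "b + t"] by (simp add: vtx_eq_iff)
qed (simp add: vtx_eq_iff)

lemma walk_mod [simp]: "walk (a mod int n) w = walk a w"
  by (rule walk_cong) (simp add: mod_eq_dvd_iff[symmetric])

lemma allowed_path_Cons:
  "allowed_path n S (x # p) \<longleftrightarrow> x < n \<and> (p = [] \<or> arr x (hd p)) \<and> allowed_path n S p"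
  by (cases p) (auto simp: allowed_path_def nth_Cons split: nat.splits)

lemma allowed_path_walk:
  assumes "w \<in> words m"
  shows "allowed_path n S (walk a w)"
  using assms
proof (induction w arbitrary: a m)
  case Nil
  show ?case by (simp add: allowed_path_Cons vtx_less) (simp add: allowed_path_def)
next
  case (Cons t w)
  then have "w \<in> words (length w)" "t = 1 \<or> t = int s" by (auto simp: words_def)
  then show ?case using Cons.IH by (auto simp: allowed_path_Cons vtx_less arr_vtx)
qed

lemma walk_exists:
  assumes "allowed_path n S p" "length p = Suc m"
  shows "\<exists>a. \<exists>w\<in>words m. p = walk a w"
  using assms
proof (induction p arbitrary: m)
  case (Cons x p)
  show ?case
  proof (cases "p = []")
    case True
    then have "x # p = walk (int x) []" using Cons.prems by (simp add: allowed_path_Cons vtx_int)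
    then show ?thesis using True Cons.prems by (auto simp: words_def)
  next
    case False
    then obtain k where k: "m = Suc k" "length p = Suc k" using Cons.prems by (cases p) auto
    then obtain b w where w: "w \<in> words k" "p = walk b w"
      using Cons by (auto simp: allowed_path_Cons)
    then have "arr x (vtx b)" using Cons.prems False by (simp add: allowed_path_Cons)
    then obtain t where "x = vtx (b - t)" "t = 1 \<or> t = int s" using arr_to_vtx by blast
    then have "x # p = walk (b - t) (t # w)" "t # w \<in> words m" using w k by (auto simp: words_def)
    then show ?thesis by blast
  qed
qed simp

lemma A_eqI:
  assumes "u \<in> A m" "u' \<in> A m" "\<And>a w. w \<in> words m \<Longrightarrow> u (walk a w) = u' (walk a w)"
  shows "u = u'"
proof
  fix p
  show "u p = u' p"
  proof (cases "allowed_path n S p \<and> length p = Suc m")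
    case True
    then show ?thesis using walk_exists assms(3) by blast
  next
    case False
    then have "u p = 0" "u' p = 0" using assms(1,2) by (auto simp: A_space_def)
    then show ?thesis by simp
  qed
qed

fun steps :: "nat list \<Rightarrow> int list" where
  "steps (x # y # p) = ((int y - int x) mod int n) # steps (y # p)"
| "steps p = []"

lemma steps_walk: "set w \<subseteq> {0..<int n} \<Longrightarrow> steps (walk a w) = w"
proof (induction w arbitrary: a)
  case (Cons t w)
  obtain r where r: "walk (a + t) w = vtx (a + t) # r" using walk_hd by blast
  then have "steps (vtx (a + t) # r) = w" using Cons.IH[of "a + t"] Cons.prems by simp
  then show ?case using Cons.prems by (simp add: r int_vtx mod_simps)
qed simp

text \<open>Prescribes coefficients by start vertex and step word. Only the representative of the
  start in \<open>{0..<n}\<close> reaches \<open>g\<close>, so \<open>g\<close> is always chosen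
  \<open>n\<close>-periodic.\<close>

definition mk_chain :: "nat \<Rightarrow> (int \<Rightarrow> int list \<Rightarrow> 'k) \<Rightarrow> 'k::field chain" where
  "mk_chain m g p = (if length p = Suc m \<and> allowed_path n S p then g (int (hd p)) (steps p) else 0)"

lemma mk_chain_in_A: "mk_chain m g \<in> A m"
  by (simp add: A_space_def mk_chain_def)

lemma mk_chain_walk:
  assumes "w \<in> words m" "\<And>a. g (a mod int n) w = g a w"
  shows "mk_chain m g (walk a w) = g a w"
proof -
  have "{1, int s} \<subseteq> {0..<int n}" using s_lt n_ge by auto
  then have "set w \<subseteq> {0..<int n}" using assms(1) unfolding words_def by blast
  then show ?thesis
    using assms allowed_path_walk[OF assms(1)]
    by (simp add: mk_chain_def steps_walk int_vtx words_def)
qed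

lemma sum_append_walk:
  assumes "u \<in> A m"
  shows "(\<Sum>v<n. u (r @ walk a w @ [v])) = u (r @ walk a (w @ [1])) + u (r @ walk a (w @ [int s]))"
proof -
  obtain r' where r': "walk a w = r' @ [vtx (a + sum_list w)]" using walk_last by blast
  show ?thesis
    using sum_after_vtx[OF assms, of "r @ r'" "a + sum_list w" "[]"] by (simp add: walk_append r')
qed

lemma sum_prepend_walk:
  assumes "u \<in> A m"
  shows "(\<Sum>v<n. u (v # walk a w)) = u (walk (a - 1) (1 # w)) + u (walk (a - int s) (int s # w))"
proof -
  obtain r where r: "walk a w = vtx a # r" using walk_hd by blast
  show ?thesis using sum_before_vtx[OF assms, of a r] by (simp add: r)
qed

section \<open>Boundary and \<open>\<Omega>\<close> relations on words\<close>

text \<open>The step \<open>t\<close> is congruent to a sum of two arrow steps, so an edge of step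
  \<open>t\<close> can receive an inserted vertex.\<close>

definition splittable :: "int \<Rightarrow> bool" where
  "splittable t \<longleftrightarrow> int n dvd t - 2 \<or> int n dvd t - 1 - int s \<or> int n dvd t - 2 * int s"

lemma not_splittable_1: "\<not> splittable 1"
  unfolding splittable_def
  using not_dvd_small[of "1 - 2"] not_dvd_small[of "1 - 1 - int s"] not_dvd_small[of "1 - 2 * int s"]
    s_gt s_lt n_ge by auto

text \<open>Modulo \<open>n\<close>, the step \<open>s\<close> can only split as
  \<open>1 + 1\<close>, which happens just for \<open>s = 2\<close>. Here the two cases of the
  theorem diverge.\<close>

lemma not_splittable_s: "s \<noteq> 2 \<Longrightarrow> \<not> splittable (int s)"
  unfolding splittable_def
  using not_dvd_small[of "int s - 2"] not_dvd_small[of "int s - 1 - int s"]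
    not_dvd_small[of "int s - 2 * int s"] s_gt s_lt n_ge by auto

text \<open>Insertions inside the walk vanish since no edge splits; those at its two ends remain.
  The prefix \<open>r\<close> carries the induction and later a leading edge that does
  split.\<close>

lemma ins_bd_walk:
  assumes "u \<in> A m" "\<And>t. t \<in> set w \<Longrightarrow> \<not> splittable t"
  shows "ins_bd n (\<lambda>p. u (r @ p)) (walk a w) =
    (\<Sum>v<n. u (r @ v # walk a w)) + (-1) ^ Suc (length w) * (\<Sum>v<n. u (r @ walk a w @ [v]))"
  using assms(2)
proof (induction w arbitrary: a r)
  case (Cons t w)
  obtain p where p: "walk (a + t) w = vtx (a + t) # p" using walk_hd by blast
  have "(\<Sum>v<n. u (r @ vtx a # v # walk (a + t) w)) = 0"
    unfolding p by (rule sum_between_vtx_eq_0[OF assms(1)])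
      (use Cons.prems[of t] in \<open>auto simp: splittable_def\<close>)
  then show ?case using Cons.IH[of "r @ [vtx a]" "a + t"] Cons.prems by simp
qed simp

lemma \<Omega>_middle:
  assumes "u \<in> \<Omega> m" "\<not> int n dvd c - 1" "\<not> int n dvd c - int s"
  shows "u (walk a (w1 @ 1 # (c - 1) # w2)) + u (walk a (w1 @ int s # (c - int s) # w2)) = 0"
proof -
  define b where "b = a + sum_list w1"
  obtain r1 where r1: "walk a w1 = r1 @ [vtx b]" using walk_last b_def by blast
  obtain r2 where r2: "walk (b + c) w2 = vtx (b + c) # r2" using walk_hd by blast
  have "walk a (w1 @ t # (c - t) # w2) = r1 @ vtx b # vtx (b + t) # vtx (b + c) # r2" for t
    by (simp add: walk_append r1 r2 b_def[symmetric])
  then show ?thesis using \<Omega>_non_arrow[OF assms] by metis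
qed

text \<open>The total \<open>1 + s\<close> is not an arrow, and the two ways around it are the two
  orders of its steps.\<close>

lemma \<Omega>_swap:
  assumes "u \<in> \<Omega> m"
  shows "u (walk a (w1 @ 1 # int s # w2)) = - u (walk a (w1 @ int s # 1 # w2))"
proof -
  have "\<not> int n dvd (1 + int s) - 1" "\<not> int n dvd (1 + int s) - int s"
    using not_dvd_small[of "(1 + int s) - 1"] not_dvd_small[of "(1 + int s) - int s"] s_gt s_lt by auto
  from \<Omega>_middle[OF assms this] show ?thesis by (simp add: eq_neg_iff_add_eq_0)
qed

lemma walk_non_arrow:
  assumes "u \<in> A m" "\<not> int n dvd t - 1" "\<not> int n dvd t - int s"
  shows "u (walk a (w1 @ t # w2)) = 0"
proof -
  define b where "b = a + sum_list w1"
  obtain r1 where r1: "walk a w1 = r1 @ [vtx b]" using walk_last b_def by blast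
  obtain r2 where r2: "walk (b + t) w2 = vtx (b + t) # r2" using walk_hd by blast
  have "walk a (w1 @ t # w2) = r1 @ vtx b # vtx (b + t) # r2"
    by (simp add: walk_append r1 r2 b_def[symmetric])
  moreover have "\<not> arr (vtx b) (vtx (b + t))" using assms(2,3) by (simp add: arr_vtx_vtx)
  ultimately show ?thesis using A_edge[OF assms(1)] by metis
qed

text \<open>The total \<open>2 * s\<close> is not an arrow, and the companion path through the step
  1 would need the step \<open>2 * s - 1\<close>, also not an arrow.\<close>

lemma \<Omega>_s_s:
  assumes "u \<in> \<Omega> m"
  shows "u (walk a (w1 @ int s # int s # w2)) = 0"
proof -
  have "\<not> int n dvd 2 * int s - 1" "\<not> int n dvd 2 * int s - int s"
    "\<not> int n dvd (2 * int s - 1) - 1" "\<not> int n dvd (2 * int s - 1) - int s"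
    using not_dvd_small[of "2 * int s - 1"] not_dvd_small[of "2 * int s - int s"]
      not_dvd_small[of "2 * int s - 1 - 1"] not_dvd_small[of "2 * int s - 1 - int s"] s_gt s_lt by auto
  then show ?thesis
    using \<Omega>_middle[OF assms, of "2 * int s" a w1 w2]
      walk_non_arrow[OF \<Omega>_subset_A[OF assms], of "2 * int s - 1" a "w1 @ [1]" w2] by simp
qed

text \<open>If \<open>s \<noteq> 2\<close>, the total 2 is not an arrow, and the companion path
  would continue by \<open>2 - s\<close>, also not an arrow. For \<open>s = 2\<close> the total is
  itself an arrow and imposes no condition.\<close>

lemma \<Omega>_1_1:
  assumes "u \<in> \<Omega> m" "s \<noteq> 2"
  shows "u (walk a (w1 @ 1 # 1 # w2)) = 0"
proof -
  have "\<not> int n dvd 2 - 1" "\<not> int n dvd 2 - int s"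
    "\<not> int n dvd (2 - int s) - 1" "\<not> int n dvd (2 - int s) - int s"
    using not_dvd_small[of "2 - 1"] not_dvd_small[of "2 - int s"]
      not_dvd_small[of "2 - int s - 1"] not_dvd_small[of "2 - int s - int s"] s_gt s_lt assms(2) by auto
  then show ?thesis
    using \<Omega>_middle[OF assms(1), of 2 a w1 w2]
      walk_non_arrow[OF \<Omega>_subset_A[OF assms(1)], of "2 - int s" a "w1 @ [int s]" w2] by simp
qed

section \<open>Summation over the residues modulo \<open>n\<close>\<close>

lemma sum_shift:
  fixes h :: "int \<Rightarrow> 'k::field"
  assumes "\<And>a. h (a mod int n) = h a"
  shows "(\<Sum>b<n. h (int b + t)) = (\<Sum>b<n. h (int b))"
proof (rule sum.reindex_bij_witness[where i = "\<lambda>b. vtx (int b - t)" and j = "\<lambda>b. vtx (int b + t)"])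
  show "vtx (int (vtx (int b + t)) - t) = b" if "b \<in> {..<n}" for b
  proof -
    have "vtx (int (vtx (int b + t)) - t) = vtx ((int b + t) mod int n - t)" by (simp add: int_vtx)
    also have "\<dots> = vtx (int b)" unfolding vtx_eq_iff by (simp add: mod_eq_dvd_iff[symmetric] mod_simps)
    finally show ?thesis using that by (simp add: vtx_int)
  qed
  show "vtx (int (vtx (int b - t)) + t) = b" if "b \<in> {..<n}" for b
  proof -
    have "vtx (int (vtx (int b - t)) + t) = vtx ((int b - t) mod int n + t)" by (simp add: int_vtx)
    also have "\<dots> = vtx (int b)" unfolding vtx_eq_iff by (simp add: mod_eq_dvd_iff[symmetric] mod_simps)
    finally show ?thesis using that by (simp add: vtx_int)
  qed
  show "h (int (vtx (int b + t))) = h (int b + t)" for b by (simp add: int_vtx assms)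
qed (simp_all add: vtx_less)

text \<open>Summing a periodic function around the cycle is obstructed only by its total, which is
  placed at the residue 0.\<close>

lemma antidifference:
  fixes f :: "int \<Rightarrow> 'k::field"
  assumes f: "\<And>a. f (a mod int n) = f a"
  obtains g where "\<And>a. g (a mod int n) = g a"
    "\<And>a. g (a - 1) - g a = f a - (if int n dvd a then \<Sum>b<n. f (int b) else 0)"
proof -
  \<comment> \<open>Partial sums starting from \<open>g 0 = 0\<close>; the total appears as the jump
    when passing from \<open>n - 1\<close> back to 0.\<close>
  define g where "g a = - (\<Sum>b<vtx a. f (int (Suc b)))" for a
  have "g (a - 1) - g a = f a - (if int n dvd a then \<Sum>b<n. f (int b) else 0)" for a
  proof (cases "vtx a")
    case 0
    have va: "vtx a = vtx 0" using 0 by (simp add: vtx_def)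
    then have dvd: "int n dvd a" by (simp add: vtx_eq_iff)
    obtain k where k: "n = Suc k" using n_ge by (cases n) auto
    have eq: "a - 1 - int k = a - int n" and "k < n" using k by simp_all
    have "vtx (a - 1) = vtx (int k)" unfolding vtx_eq_iff eq using dvd by simp
    then have "vtx (a - 1) = k" using vtx_int[OF \<open>k < n\<close>] by simp
    moreover have "f a = f 0" using f[of a] dvd by (simp add: dvd_imp_mod_0)
    moreover have "(\<Sum>b<n. f (int b)) = f 0 + (\<Sum>b<k. f (int (Suc b)))"
      unfolding k by (subst sum.lessThan_Suc_shift) simp
    ultimately show ?thesis using dvd 0 by (simp add: g_def)
  next
    case (Suc k)
    have a: "a mod int n = int (Suc k)" using Suc int_vtx[of a] by simp
    then have "\<not> int n dvd a" by (simp add: dvd_eq_mod_eq_0)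
    moreover have "vtx (a - 1) = k"
    proof -
      have eq: "a - 1 - int k = a - a mod int n" using a by simp
      have "vtx (a - 1) = vtx (int k)" unfolding vtx_eq_iff eq by (rule dvd_minus_mod)
      then show ?thesis using vtx_less[of a] Suc by (simp add: vtx_int)
    qed
    moreover have "f a = f (int (Suc k))" using f[of a] a by simp
    ultimately show ?thesis using Suc by (simp add: g_def)
  qed
  then show thesis using that[of g] by (simp add: g_def)
qed


section \<open>Criteria for the dimension of homology\<close>

lemma \<Omega>_add_scale:
  assumes "u \<in> \<Omega> m" "u' \<in> \<Omega> m"
  shows "(\<lambda>p. u p + c * u' p) \<in> \<Omega> m"
proof (rule \<Omega>I)
  show "(\<lambda>p. u p + c * u' p) \<in> A m"
    using \<Omega>_subset_A[OF assms(1)] \<Omega>_subset_A[OF assms(2)]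
    by (auto simp: A_space_def) (metis add_0 mult_zero_right)+
  fix r1 b d r2
  assume d: "\<not> int n dvd d - 1" "\<not> int n dvd d - int s"
  let ?p = "r1 @ vtx b # vtx (b + 1) # vtx (b + d) # r2"
  let ?q = "r1 @ vtx b # vtx (b + int s) # vtx (b + d) # r2"
  have "u ?p + c * u' ?p + (u ?q + c * u' ?q) = (u ?p + u ?q) + c * (u' ?p + u' ?q)"
    by (simp add: algebra_simps)
  then show "u ?p + c * u' ?p + (u ?q + c * u' ?q) = 0"
    using \<Omega>_non_arrow[OF assms(1) d] \<Omega>_non_arrow[OF assms(2) d] by simp
qed

lemma zero_in_\<Omega>: "(\<lambda>_. 0) \<in> \<Omega> m"
  by (rule \<Omega>I) (simp_all add: zero_in_A)

lemma path_bd_zero: "path_bd (\<lambda>_. 0 :: 'k::field) = (\<lambda>_. 0)"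
  by (simp add: path_bd_def fun_eq_iff)

lemma zero_in_boundaries: "(\<lambda>_. 0) \<in> boundaries n S m"
proof -
  have "path_bd (\<lambda>_. 0) \<in> boundaries n S m"
    unfolding boundaries_def by (intro imageI zero_in_\<Omega>)
  then show ?thesis by (simp add: path_bd_zero)
qed

text \<open>Point masses at the finitely many vertex lists of length \<open>Suc m\<close> span
  \<open>A m\<close>. This supplies the finiteness for \<open>dim_insert_chain\<close>.\<close>

lemma boundaries_in_span: "\<exists>F. finite F \<and> boundaries n S m \<subseteq> (chains.span F :: 'k::field chain set)"
proof -
  let ?L = "{p. set p \<subseteq> {..<n} \<and> length p = Suc m}"
  let ?\<delta> = "\<lambda>p q. if q = p then 1 else 0 :: 'k"
  have fin: "finite ?L" by (simp add: finite_lists_length_eq)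
  have apply_sum: "sum f L q = (\<Sum>p\<in>L. f p q)" for f :: "nat list \<Rightarrow> 'k chain" and L q
    by (induction L rule: infinite_finite_induct) simp_all
  have "u \<in> chains.span (?\<delta> ` ?L)" if "u \<in> A m" for u
  proof -
    have "u = (\<Sum>p\<in>?L. chain_scale (u p) (?\<delta> p))"
    proof
      fix q
      have "(\<Sum>p\<in>?L. u p * ?\<delta> p q) = (\<Sum>p\<in>?L. if p = q then u p else 0)"
        by (rule sum.cong) auto
      also have "\<dots> = u q"
        using fin A_length[OF that, of q] A_vertices[OF that, of q] by (auto simp: sum.delta')
      finally show "u q = (\<Sum>p\<in>?L. chain_scale (u p) (?\<delta> p)) q" by (simp add: apply_sum)
    qed
    also have "\<dots> \<in> chains.span (?\<delta> ` ?L)"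
      by (intro chains.span_sum chains.span_scale chains.span_base) blast
    finally show ?thesis .
  qed
  moreover have "boundaries n S m \<subseteq> A m"
    using boundaries_subset_cycles \<Omega>_subset_A by (fastforce simp: cycles_def)
  ultimately show ?thesis using fin by blast
qed

lemma homology_dim_0I:
  assumes "\<And>u :: 'k::field chain. u \<in> cycles n S m \<Longrightarrow> u \<in> boundaries n S m"
  shows "path_homology_dim TYPE('k) n S m 0"
proof -
  have "cycles n S m = (boundaries n S m :: 'k chain set)"
    using assms boundaries_subset_cycles by blast
  then show ?thesis by (simp add: path_homology_dim_def)
qed

lemma homology_dim_1I:
  fixes v :: "'k::field chain"
  assumes "v \<in> cycles n S m" "v \<notin> chains.span (boundaries n S m)"
    "\<And>u :: 'k chain. u \<in> cycles n S m \<Longrightarrow> \<exists>c. (\<lambda>p. u p + c * v p) \<in> boundaries n S m"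
  shows "path_homology_dim TYPE('k) n S m 1"
proof -
  let ?B = "boundaries n S m :: 'k chain set"
  obtain F where "finite F" "?B \<subseteq> chains.span F" using boundaries_in_span by blast
  then have dim: "chains.dim (insert v ?B) = chains.dim ?B + 1"
    using dim_insert_chain assms(2) by blast
  have "u \<in> chains.span (insert v ?B)" if u: "u \<in> cycles n S m" for u
  proof -
    obtain c where c: "(\<lambda>p. u p + c * v p) \<in> ?B" using assms(3)[OF u] by blast
    have "u = (\<lambda>p. u p + c * v p) - chain_scale c v" by (simp add: fun_eq_iff)
    also have "\<dots> \<in> chains.span (insert v ?B)"
      using c by (intro chains.span_diff chains.span_scale chains.span_base) auto
    finally show ?thesis .
  qed
  then have "chains.dim (cycles n S m :: 'k chain set) = chains.dim (insert v ?B)"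
    using assms(1) boundaries_subset_cycles by (intro dim_eq_if_spans) auto
  then show ?thesis using dim by (simp add: path_homology_dim_def)
qed

lemma homology_dim_2I:
  fixes v1 v2 :: "'k::field chain"
  assumes "v1 \<in> cycles n S m" "v2 \<in> cycles n S m"
    "v1 \<notin> chains.span (boundaries n S m)" "v2 \<notin> chains.span (insert v1 (boundaries n S m))"
    "\<And>u :: 'k chain. u \<in> cycles n S m \<Longrightarrow>
      \<exists>c1 c2. (\<lambda>p. u p + (c1 * v1 p + c2 * v2 p)) \<in> boundaries n S m"
  shows "path_homology_dim TYPE('k) n S m 2"
proof -
  let ?B = "boundaries n S m :: 'k chain set"
  let ?X = "insert v2 (insert v1 ?B)"
  obtain F where F: "finite F" "?B \<subseteq> chains.span F" using boundaries_in_span by blast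
  then have "insert v1 ?B \<subseteq> chains.span (insert v1 F)"
    using chains.span_mono[of F "insert v1 F"] chains.span_base by blast
  then have "chains.dim ?X = chains.dim (insert v1 ?B) + 1"
    using dim_insert_chain[of "insert v1 F"] F(1) assms(4) by blast
  then have dim: "chains.dim ?X = chains.dim ?B + 2"
    using dim_insert_chain[OF F assms(3)] by simp
  have "u \<in> chains.span ?X" if u: "u \<in> cycles n S m" for u
  proof -
    obtain c1 c2 where c: "(\<lambda>p. u p + (c1 * v1 p + c2 * v2 p)) \<in> ?B" using assms(5)[OF u] by blast
    have "u = (\<lambda>p. u p + (c1 * v1 p + c2 * v2 p)) - (chain_scale c1 v1 + chain_scale c2 v2)"
      by (simp add: fun_eq_iff)
    also have "\<dots> \<in> chains.span ?X"
      using c by (intro chains.span_diff chains.span_add chains.span_scale chains.span_base) auto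
    finally show ?thesis .
  qed
  then have "chains.dim (cycles n S m :: 'k chain set) = chains.dim ?X"
    using assms(1,2) boundaries_subset_cycles by (intro dim_eq_if_spans) auto
  then show ?thesis using dim by (simp add: path_homology_dim_def)
qed

section \<open>Boundary formulas and homology in degree 0\<close>

lemma path_bd_walk:
  assumes "u \<in> A (Suc m)" "\<And>t. t \<in> set w \<Longrightarrow> \<not> splittable t"
  shows "path_bd u (walk a w) = u (walk (a - 1) (1 # w)) + u (walk (a - int s) (int s # w)) +
    (-1) ^ Suc (length w) * (u (walk a (w @ [1])) + u (walk a (w @ [int s])))"
  unfolding path_bd_A_Suc[OF assms(1)]
  using ins_bd_walk[OF assms, where r = "[]"]
    sum_append_walk[OF assms(1), of "[]" a w] sum_prepend_walk[OF assms(1), of a w]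
  by (simp del: walk.simps)

lemma path_bd_1:
  assumes "u \<in> A 1"
  shows "path_bd u (walk a []) =
    u (walk (a - 1) [1]) - u (walk a [1]) + (u (walk (a - int s) [int s]) - u (walk a [int s]))"
  using path_bd_walk[of u 0 "[]" a] assms by simp

lemma words_0: "words 0 = {[]}"
  by (auto simp: words_def)

lemma words_Suc: "words (Suc m) = {t # w |t w. (t = 1 \<or> t = int s) \<and> w \<in> words m}"
  by (auto simp: words_def length_Suc_conv)

lemma shift_invariant_const:
  fixes h :: "int \<Rightarrow> 'a"
  assumes "\<And>a. h (a - 1) = h a"
  shows "h a = h 0"
proof (induction a rule: int_induct[where k = 0])
  case (step1 i)
  then show ?case using assms[of "i + 1"] by simp
next
  case (step2 i)
  then show ?case using assms[of i] by simp
qed simp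

text \<open>The class is that of the vertex 0, detected by the sum of all coefficients. By
  \<open>antidifference\<close>, arrows of step 1 move any 0-chain onto the vertex 0.\<close>

lemma homology_0: "path_homology_dim TYPE('k::field) n S 0 1"
proof (rule homology_dim_1I)
  define \<phi> :: "'k chain \<Rightarrow> 'k" where "\<phi> x = (\<Sum>b<n. x (walk (int b) []))" for x
  let ?v = "mk_chain 0 (\<lambda>a w. if int n dvd a then 1 else 0) :: 'k chain"
  have v: "?v (walk a []) = (if int n dvd a then 1 else 0)" for a
    by (subst mk_chain_walk) (auto simp: words_0 dvd_mod_iff)
  show "?v \<in> cycles n S 0"
    by (simp add: cycles_def Omega_space_def mk_chain_in_A path_bd_A_0)
  show "?v \<notin> chains.span (boundaries n S 0)"
  proof (rule not_in_span_if_functional[where f = \<phi>])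
    fix x :: "'k chain"
    assume "x \<in> boundaries n S 0"
    then obtain u where "u \<in> A 1" "x = path_bd u" by (auto simp: boundaries_def Omega_space_def)
    then have "\<phi> x = (\<Sum>b<n. u (walk (int b - 1) [1]) - u (walk (int b) [1]) +
        (u (walk (int b - int s) [int s]) - u (walk (int b) [int s])))"
      by (simp add: \<phi>_def path_bd_1 del: walk.simps)
    also have "\<dots> = 0"
      using sum_shift[of "\<lambda>a. u (walk a [1])" "-1"] sum_shift[of "\<lambda>a. u (walk a [int s])" "- int s"]
      by (simp add: sum.distrib sum_subtractf del: walk.simps)
    finally show "\<phi> x = 0" .
  next
    have "\<phi> ?v = (\<Sum>b<n. if b = 0 then 1 else 0)"
      unfolding \<phi>_def v by (rule sum.cong) (auto dest: nat_dvd_not_less)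
    then show "\<phi> ?v \<noteq> 0" using n_ge by simp
  qed (simp_all add: \<phi>_def sum.distrib sum_distrib_left)
  fix u :: "'k chain"
  assume "u \<in> cycles n S 0"
  then have u: "u \<in> A 0" by (simp add: cycles_def Omega_space_def)
  define f where "f a = u (walk a [])" for a
  have f: "f (a mod int n) = f a" for a unfolding f_def walk_mod ..
  obtain g where g: "\<And>a. g (a mod int n) = g a"
    "\<And>a. g (a - 1) - g a = f a - (if int n dvd a then \<Sum>b<n. f (int b) else 0)"
    using antidifference[of f, OF f] by blast
  let ?w = "mk_chain 1 (\<lambda>a w. if w = [1] then g a else 0)"
  have w: "?w (walk a [1]) = g a" "?w (walk a [int s]) = 0" for a
    using s_gt by (subst mk_chain_walk; auto simp: words_def g)+
  have w\<Omega>: "?w \<in> \<Omega> 1" by (simp add: Omega_space_def mk_chain_in_A del: One_nat_def)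
  have "path_bd ?w = (\<lambda>p. u p + - (\<Sum>b<n. f (int b)) * ?v p)"
  proof (rule A_eqI)
    show "path_bd ?w \<in> A 0"
      using path_bd_\<Omega>(1)[of ?w 0] w\<Omega> \<Omega>_subset_A by simp
    show "(\<lambda>p. u p + - (\<Sum>b<n. f (int b)) * ?v p) \<in> A 0"
      by (rule \<Omega>_subset_A, rule \<Omega>_add_scale) (simp_all add: u Omega_space_def mk_chain_in_A)
    show "path_bd ?w (walk a x) = u (walk a x) + - (\<Sum>b<n. f (int b)) * ?v (walk a x)"
      if "x \<in> words 0" for a x
    proof -
      have "path_bd ?w (walk a []) = g (a - 1) - g a"
        using path_bd_1[of ?w a] by (simp add: w mk_chain_in_A del: walk.simps One_nat_def)
      then show ?thesis
        using that by (simp add: words_0 g(2) v f_def[symmetric] del: walk.simps One_nat_def)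
    qed
  qed
  moreover have "path_bd ?w \<in> boundaries n S 0"
    unfolding boundaries_def using w\<Omega> by simp
  ultimately have "(\<lambda>p. u p + - (\<Sum>b<n. f (int b)) * ?v p) \<in> boundaries n S 0" by simp
  then show "\<exists>c. (\<lambda>p. u p + c * ?v p) \<in> boundaries n S 0" by (rule exI)
qed


section \<open>Cycles of degree 1 and coordinates on \<open>\<Omega>\<close>\<close>

lemma path_bd_in_boundaries: "u \<in> \<Omega> (Suc m) \<Longrightarrow> path_bd u \<in> boundaries n S m"
  by (simp add: boundaries_def)

lemma words_1: "words 1 = {[1], [int s]}"
  by (auto simp: words_Suc words_0)

lemma words_2: "words 2 = {[1, 1], [1, int s], [int s, 1], [int s, int s]}"
  by (auto simp: words_Suc words_0 numeral_2_eq_2)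

lemma mk_chain_1_walk:
  assumes "\<And>a. f (a mod int n) = f a" "\<And>a. g (a mod int n) = g a"
  shows "mk_chain 1 (\<lambda>a w. if w = [1] then f a else g a) (walk a [1]) = f a"
    "mk_chain 1 (\<lambda>a w. if w = [1] then f a else g a) (walk a [int s]) = g a"
  using s_gt by (subst mk_chain_walk; simp add: words_1 assms del: One_nat_def)+

lemma A_1_in_\<Omega>: "u \<in> A 1 \<Longrightarrow> u \<in> \<Omega> 1"
  by (simp add: Omega_space_def)

text \<open>Kirchhoff's law: at each vertex \<open>a\<close>, inflow along both kinds of arrows
  equals outflow.\<close>

lemma cycles_1_iff:
  "u \<in> cycles n S 1 \<longleftrightarrow> u \<in> A 1 \<and> (\<forall>a. u (walk (a - 1) [1]) - u (walk a [1]) +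
    (u (walk (a - int s) [int s]) - u (walk a [int s])) = 0)"
proof
  assume "u \<in> cycles n S 1"
  then have u: "u \<in> A 1" "path_bd u = (\<lambda>_. 0)" by (auto simp: cycles_def Omega_space_def)
  then show "u \<in> A 1 \<and> (\<forall>a. u (walk (a - 1) [1]) - u (walk a [1]) +
    (u (walk (a - int s) [int s]) - u (walk a [int s])) = 0)"
    using path_bd_1[OF u(1)] by metis
next
  assume u: "u \<in> A 1 \<and> (\<forall>a. u (walk (a - 1) [1]) - u (walk a [1]) +
    (u (walk (a - int s) [int s]) - u (walk a [int s])) = 0)"
  have \<Omega>: "u \<in> \<Omega> (Suc 0)" using A_1_in_\<Omega>[of u] u by (simp del: walk.simps)
  have "path_bd u = (\<lambda>_. 0)"
  proof (rule A_eqI)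
    show "path_bd u \<in> A 0" using path_bd_\<Omega>(1)[OF \<Omega>] \<Omega>_subset_A by blast
    show "path_bd u (walk a w) = 0" if "w \<in> words 0" for a w
      using that path_bd_1[of u a] u unfolding words_0 by (simp del: walk.simps One_nat_def)
  qed (rule zero_in_A)
  then show "u \<in> cycles n S 1" using \<Omega> by (simp add: cycles_def)
qed

lemma cycles_1D:
  assumes "u \<in> cycles n S 1"
  shows "u \<in> A 1" "u (walk (a - 1) [1]) - u (walk a [1]) +
    (u (walk (a - int s) [int s]) - u (walk a [int s])) = 0"
  using assms unfolding cycles_1_iff by blast+

text \<open>The letter \<open>s\<close> passes \<open>i\<close> ones by swaps, each costing a
  sign.\<close>

lemma \<Omega>_move:
  assumes "u \<in> \<Omega> m"
  shows "u (walk a (w1 @ replicate i 1 @ int s # w2)) =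
    (-1) ^ i * u (walk a (w1 @ int s # replicate i 1 @ w2))"
proof (induction i arbitrary: w2)
  case (Suc i)
  have "u (walk a (w1 @ replicate (Suc i) 1 @ int s # w2)) =
      u (walk a ((w1 @ replicate i 1) @ 1 # int s # w2))"
    by (simp add: replicate_app_Cons_same del: walk.simps)
  also have "\<dots> = - u (walk a (w1 @ replicate i 1 @ int s # 1 # w2))"
    using \<Omega>_swap[OF assms, of a "w1 @ replicate i 1" w2] by (simp del: walk.simps)
  also have "\<dots> = (-1) ^ Suc i * u (walk a (w1 @ int s # replicate (Suc i) 1 @ w2))"
    by (simp add: Suc.IH replicate_app_Cons_same del: walk.simps)
  finally show ?case .
qed simp

text \<open>Here \<open>i\<close> is the position of the first \<open>s\<close>. The word left after
  removing that letter is recorded because the letter will be moved to the front.\<close>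

lemma word_cases:
  assumes "w \<in> words m"
  shows "w = replicate m 1 \<or> (\<exists>i w'. w = replicate i 1 @ int s # w' \<and> replicate i 1 @ w' \<in> words (m - 1))"
  using assms
proof (induction m arbitrary: w)
  case (Suc m)
  then obtain t w1 where w: "w = t # w1" "t = 1 \<or> t = int s" "w1 \<in> words m" by (auto simp: words_Suc)
  show ?case
  proof (cases "t = int s")
    case True
    then have "w = replicate 0 1 @ int s # w1 \<and> replicate 0 1 @ w1 \<in> words (Suc m - 1)" using w by simp
    then show ?thesis by blast
  next
    case False
    then have t: "t = 1" using w(2) by simp
    from Suc.IH[OF w(3)] show ?thesis
    proof
      assume "\<exists>i w'. w1 = replicate i 1 @ int s # w' \<and> replicate i 1 @ w' \<in> words (m - 1)"
      then obtain i w' where i: "w1 = replicate i 1 @ int s # w'" "replicate i 1 @ w' \<in> words (m - 1)"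
        by blast
      have "m \<noteq> 0" using w(3) i(1) by (auto simp: words_def)
      then have "w = replicate (Suc i) 1 @ int s # w' \<and> replicate (Suc i) 1 @ w' \<in> words (Suc m - 1)"
        using i w(1) t by (cases m) (auto simp: words_Suc)
      then show ?thesis by blast
    qed (simp add: w(1) t)
  qed
qed (simp add: words_0)

text \<open>The words \<open>1^(k+1)\<close> and \<open>s 1^k\<close> serve as coordinates: the
  first \<open>s\<close> of any other word can be moved to the front up to sign, and a further
  \<open>s\<close> forces the value 0.\<close>

lemma \<Omega>_eqI:
  fixes u u' :: "'k::field chain"
  assumes "u \<in> \<Omega> (Suc k)" "u' \<in> \<Omega> (Suc k)"
    and "\<And>a. u (walk a (replicate (Suc k) 1)) = u' (walk a (replicate (Suc k) 1))"
    and "\<And>a. u (walk a (int s # replicate k 1)) = u' (walk a (int s # replicate k 1))"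
  shows "u = u'"
proof (rule A_eqI)
  fix a w
  assume w: "w \<in> words (Suc k)"
  have *: "u (walk a (int s # x)) = u' (walk a (int s # x))" if x: "x \<in> words k" for x
    using word_cases[OF x]
  proof
    assume "\<exists>i w'. x = replicate i 1 @ int s # w' \<and> replicate i 1 @ w' \<in> words (k - 1)"
    then obtain i w' where i: "x = replicate i 1 @ int s # w'" by blast
    \<comment> \<open>The second \<open>s\<close> is moved next to the leading one, creating the
      forbidden factor \<open>s s\<close>.\<close>
    have z: "v (walk a (int s # x)) = 0" if "v \<in> \<Omega> (Suc k)" for v :: "'k chain"
      using \<Omega>_move[OF that, of a "[int s]" i w'] \<Omega>_s_s[OF that, of a "[]" "replicate i 1 @ w'"]
      by (simp add: i del: walk.simps)
    show ?thesis using z[OF assms(1)] z[OF assms(2)] by simp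
  qed (use assms(4) in simp)
  show "u (walk a w) = u' (walk a w)"
    using word_cases[OF w]
  proof
    assume "\<exists>i w'. w = replicate i 1 @ int s # w' \<and> replicate i 1 @ w' \<in> words (Suc k - 1)"
    then obtain i w' where i: "w = replicate i 1 @ int s # w'" "replicate i 1 @ w' \<in> words k"
      by auto
    show ?thesis
      using \<Omega>_move[OF assms(1), of a "[]" i w'] \<Omega>_move[OF assms(2), of a "[]" i w'] *[OF i(2)]
      by (simp add: i(1) del: walk.simps)
  qed (use assms(3) in simp)
qed (use assms(1,2) \<Omega>_subset_A in auto)

text \<open>The step 1 never splits, so only insertions at the ends count. Moving an appended
  \<open>s\<close> to the front gives \<open>(-1)^k\<close>, which turns the end sign
  \<open>(-1)^(k+1)\<close> into -1.\<close>

lemma path_bd_ones: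
  assumes "u \<in> \<Omega> (Suc k)"
  shows "path_bd u (walk a (replicate k 1)) =
    u (walk (a - 1) (replicate (Suc k) 1)) - (-1) ^ k * u (walk a (replicate (Suc k) 1)) +
    (u (walk (a - int s) (int s # replicate k 1)) - u (walk a (int s # replicate k 1)))"
proof -
  have "(-1) ^ Suc k * u (walk a (replicate k 1 @ [int s])) = - u (walk a (int s # replicate k 1))"
    using \<Omega>_move[OF assms, of a "[]" k "[]"]
    by (simp add: power_add[symmetric] mult.assoc[symmetric] del: walk.simps)
  moreover have "replicate k 1 @ [1] = replicate (Suc k) (1 :: int)"
    by (simp add: replicate_append_same)
  ultimately show ?thesis
    using path_bd_walk[OF \<Omega>_subset_A[OF assms], of "replicate k 1" a] not_splittable_1
    by (simp add: algebra_simps del: walk.simps)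
qed

end

section \<open>The case \<open>s = 2\<close>: a single class in degree 1\<close>

locale circulant_2 = circulant +
  assumes s_eq: "s = 2"
begin

text \<open>The leading step \<open>s = 1 + 1\<close> splits, so it is peeled off before
  \<open>ins_bd_walk\<close> is applied to the remaining ones. Filling it in produces the all-ones
  word.\<close>

lemma path_bd_s_ones:
  assumes "u \<in> \<Omega> (Suc (Suc k))"
  shows "path_bd u (walk a (int s # replicate k 1)) =
    (-1) ^ k * u (walk a (int s # replicate (Suc k) 1)) -
    u (walk (a - 1) (int s # replicate (Suc k) 1)) - u (walk a (replicate (Suc (Suc k)) 1))"
proof -
  let ?w = "replicate k 1 :: int list"
  have u: "u \<in> A (Suc (Suc k))" using assms \<Omega>_subset_A by blast
  have "path_bd u (walk a (int s # ?w)) = (\<Sum>v<n. u (v # walk a (int s # ?w))) -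
      ins_bd n (\<lambda>p. u ([vtx a] @ p)) (walk (a + int s) ?w)"
    by (simp add: path_bd_A_Suc[OF u])
  \<comment> \<open>Prepending 1 gives \<open>1 s 1^k\<close>, the negative of
    \<open>s 1^(k+1)\<close>; prepending \<open>s\<close> gives \<open>s s\<close>, hence 0.\<close>
  also have "(\<Sum>v<n. u (v # walk a (int s # ?w))) = - u (walk (a - 1) (int s # replicate (Suc k) 1))"
    using sum_prepend_walk[OF u, of a "int s # ?w"] \<Omega>_swap[OF assms, of "a - 1" "[]" ?w]
      \<Omega>_s_s[OF assms, of "a - int s" "[]" ?w] by (simp del: walk.simps)
  also have "ins_bd n (\<lambda>p. u ([vtx a] @ p)) (walk (a + int s) ?w) =
      (\<Sum>v<n. u ([vtx a] @ v # walk (a + int s) ?w)) +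
      (-1) ^ Suc k * (\<Sum>v<n. u ([vtx a] @ walk (a + int s) ?w @ [v]))"
    using ins_bd_walk[OF u, of ?w "[vtx a]" "a + int s"] not_splittable_1 by simp
  also have "(\<Sum>v<n. u ([vtx a] @ v # walk (a + int s) ?w)) = u (walk a (replicate (Suc (Suc k)) 1))"
  proof -
    \<comment> \<open>Inserting the endpoint \<open>a + s\<close> itself would create a step 0,
      which is no arrow; only \<open>a + 1\<close> remains.\<close>
    have "\<not> int n dvd 0 - 1" "\<not> int n dvd 0 - int s"
      using not_dvd_small[of "0 - 1"] not_dvd_small[of "0 - int s"] s_gt s_lt by auto
    then have "u (walk a ([int s] @ 0 # ?w)) = 0" using walk_non_arrow[OF u] by blast
    then show ?thesis
      using sum_after_vtx[OF u, of "[]" a "walk (a + int s) ?w"] by (simp add: s_eq add.commute)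
  qed
  \<comment> \<open>An appended \<open>s\<close> can be moved beside the leading \<open>s\<close>,
    so only appending 1 survives.\<close>
  also have "(\<Sum>v<n. u ([vtx a] @ walk (a + int s) ?w @ [v])) = u (walk a (int s # replicate (Suc k) 1))"
    using sum_append_walk[OF u, of "[vtx a]" "a + int s" ?w]
      \<Omega>_move[OF assms, of a "[int s]" k "[]"] \<Omega>_s_s[OF assms, of a "[]" ?w]
    by (simp add: replicate_append_same)
  finally show ?thesis by (simp add: algebra_simps del: walk.simps)
qed

definition ones_chain :: "nat \<Rightarrow> (int \<Rightarrow> 'k) \<Rightarrow> 'k::field chain" where
  "ones_chain m f = mk_chain m (\<lambda>a w. if w = replicate m 1 then f a else 0)"

lemma steps_edge: "(int y - int x) mod int n \<in> set (steps (r1 @ x # y # r2))"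
proof (induction r1)
  case (Cons z r1)
  then show ?case by (cases r1) auto
qed simp

text \<open>Two consecutive steps 1 have total \<open>2 = s\<close>, which is an arrow, so no
  non-arrow condition meets the support of the chain.\<close>

lemma ones_chain_in_\<Omega>: "ones_chain m f \<in> \<Omega> m"
proof (rule \<Omega>I)
  show "ones_chain m f \<in> A m" by (simp add: ones_chain_def mk_chain_in_A)
  have edge: "int n dvd c - 1" if "ones_chain m f (r1 @ vtx b # vtx (b + c) # r2) \<noteq> 0" for r1 b c r2
  proof -
    have "set (steps (r1 @ vtx b # vtx (b + c) # r2)) \<subseteq> {1}"
      using that by (auto simp: ones_chain_def mk_chain_def split: if_splits)
    then have "(int (vtx (b + c)) - int (vtx b)) mod int n = 1" using steps_edge by blast
    then have "c mod int n = 1 mod int n" using n_ge by (simp add: int_vtx mod_simps)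
    then show ?thesis by (simp add: mod_eq_dvd_iff)
  qed
  fix r1 b c r2
  assume c: "\<not> int n dvd c - 1" "\<not> int n dvd c - int s"
  have "\<not> int n dvd int s - 1" using not_dvd_small[of "int s - 1"] s_gt s_lt by auto
  then have "ones_chain m f (r1 @ vtx b # vtx (b + int s) # vtx (b + c) # r2) = 0"
    using edge by blast
  moreover have "ones_chain m f (r1 @ vtx b # vtx (b + 1) # vtx (b + c) # r2) = 0"
    using edge[of "r1 @ [vtx b]" "b + 1" "c - 1" r2] c(2) by (auto simp: s_eq)
  ultimately show "ones_chain m f (r1 @ vtx b # vtx (b + 1) # vtx (b + c) # r2) +
      ones_chain m f (r1 @ vtx b # vtx (b + int s) # vtx (b + c) # r2) = 0" by simp
qed

lemma ones_chain_walk: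
  assumes "\<And>a. f (a mod int n) = f a"
  shows "ones_chain (Suc k) f (walk a (replicate (Suc k) 1)) = f a"
    "ones_chain (Suc k) f (walk a (int s # replicate k 1)) = 0"
  unfolding ones_chain_def using s_gt by (subst mk_chain_walk; auto simp: words_def assms)+

lemma homology_1: "path_homology_dim TYPE('k::field) n S 1 1"
proof (rule homology_dim_1I)
  \<comment> \<open>The flow across the cut between 0 and 1: the arrows crossing it are
    \<open>0 -> 1\<close>, \<open>0 -> 2\<close> and \<open>-1 -> 1\<close>.\<close>
  define \<phi> :: "'k chain \<Rightarrow> 'k" where
    "\<phi> x = x (walk 0 [1]) + x (walk 0 [int s]) + x (walk (- 1) [int s])" for x
  let ?v = "ones_chain 1 (\<lambda>_. 1) :: 'k chain"
  have v: "?v (walk a [1]) = 1" "?v (walk a [int s]) = 0" for a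
    using ones_chain_walk[of "\<lambda>_. 1" 0 a] by simp_all
  have v\<Omega>: "?v \<in> \<Omega> 1" by (rule ones_chain_in_\<Omega>)
  show "?v \<in> cycles n S 1"
    unfolding cycles_1_iff using v\<Omega> \<Omega>_subset_A by (simp add: v del: walk.simps One_nat_def)
  show "?v \<notin> chains.span (boundaries n S 1)"
  proof (rule not_in_span_if_functional[where f = \<phi>])
    fix x :: "'k chain"
    assume "x \<in> boundaries n S 1"
    then obtain u where u: "u \<in> \<Omega> (Suc (Suc 0))" "x = path_bd u" by (auto simp: boundaries_def)
    show "\<phi> x = 0"
      using path_bd_ones[OF u(1), of 0] path_bd_s_ones[OF u(1), of 0] path_bd_s_ones[OF u(1), of "-1"]
      by (simp add: \<phi>_def u(2) s_eq del: walk.simps)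
  qed (simp_all add: \<phi>_def v algebra_simps del: walk.simps One_nat_def)
  fix u :: "'k chain"
  assume "u \<in> cycles n S 1"
  note u = cycles_1D[OF this]
  \<comment> \<open>The flow across the cut between \<open>a\<close> and \<open>a + 1\<close>; by
    Kirchhoff's law it is the same at every cut.\<close>
  define h where "h a = u (walk a [1]) + u (walk a [int s]) + u (walk (a - 1) [int s])" for a
  have "h (a - 1) = h a" for a
    using u(2)[of a] by (simp add: h_def s_eq algebra_simps del: walk.simps)
  then have h: "h a = h 0" for a by (rule shift_invariant_const)
  \<comment> \<open>The triangles \<open>a, a + 1, a + 2\<close>, weighted so that their boundary
    has the same step-2 part as \<open>u\<close>. What remains of \<open>u\<close> is a constant
    flow along the arrows of step 1.\<close>
  let ?w = "ones_chain (Suc (Suc 0)) (\<lambda>a. - u (walk a [int s]))"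
  have w\<Omega>: "?w \<in> \<Omega> (Suc (Suc 0))" by (rule ones_chain_in_\<Omega>)
  have w: "?w (walk a (replicate (Suc (Suc 0)) 1)) = - u (walk a [int s])"
    "?w (walk a (int s # replicate (Suc 0) 1)) = 0" for a
    by (rule ones_chain_walk; simp only: walk_mod)+
  have "path_bd ?w = (\<lambda>p. u p + - h 0 * ?v p)"
  proof (rule \<Omega>_eqI)
    show "path_bd ?w \<in> \<Omega> (Suc 0)" using path_bd_\<Omega>(1)[OF w\<Omega>] .
    show "(\<lambda>p. u p + - h 0 * ?v p) \<in> \<Omega> (Suc 0)"
      using \<Omega>_add_scale[OF A_1_in_\<Omega>[OF u(1)] v\<Omega>, of "- h 0"] by simp
    show "path_bd ?w (walk a (replicate (Suc 0) 1)) =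
        u (walk a (replicate (Suc 0) 1)) + - h 0 * ?v (walk a (replicate (Suc 0) 1))" for a
      unfolding path_bd_ones[OF w\<Omega>] w using h[of a] v(1)[of a]
      by (simp add: h_def algebra_simps del: walk.simps)
    show "path_bd ?w (walk a (int s # replicate 0 1)) =
        u (walk a (int s # replicate 0 1)) + - h 0 * ?v (walk a (int s # replicate 0 1))" for a
      unfolding path_bd_s_ones[OF w\<Omega>] w using v(2)[of a] by (simp del: walk.simps)
  qed
  moreover have "path_bd ?w \<in> boundaries n S 1" using path_bd_in_boundaries[OF w\<Omega>] by simp
  ultimately have "(\<lambda>p. u p + - h 0 * ?v p) \<in> boundaries n S 1" by simp
  then show "\<exists>c. (\<lambda>p. u p + c * ?v p) \<in> boundaries n S 1" by (rule exI)
qed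

lemma homology_ge_2: "path_homology_dim TYPE('k::field) n S (Suc (Suc k)) 0"
proof (rule homology_dim_0I)
  fix u :: "'k chain"
  assume "u \<in> cycles n S (Suc (Suc k))"
  then have u: "u \<in> \<Omega> (Suc (Suc k))" and z: "path_bd u = (\<lambda>_. 0)" by (auto simp: cycles_def)
  define Q where "Q a = u (walk a (int s # replicate (Suc k) 1))" for a
  let ?w = "ones_chain (Suc (Suc (Suc k))) (\<lambda>a. - Q a)"
  have w\<Omega>: "?w \<in> \<Omega> (Suc (Suc (Suc k)))" by (rule ones_chain_in_\<Omega>)
  have w: "?w (walk a (replicate (Suc (Suc (Suc k))) 1)) = - Q a"
    "?w (walk a (int s # replicate (Suc (Suc k)) 1)) = 0" for a
    by (rule ones_chain_walk; simp only: walk_mod Q_def)+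
  \<comment> \<open>The vanishing of the boundary at \<open>s 1^k\<close> is solved for the all-ones
    coordinate.\<close>
  have P: "u (walk a (replicate (Suc (Suc k)) 1)) = (-1) ^ k * Q a - Q (a - 1)" for a
    using path_bd_s_ones[OF u, of a] unfolding z Q_def[symmetric]
    by (simp add: algebra_simps del: walk.simps)
  have "u = path_bd ?w"
  proof (rule \<Omega>_eqI[OF u])
    show "path_bd ?w \<in> \<Omega> (Suc (Suc k))" using path_bd_\<Omega>(1)[OF w\<Omega>] .
    show "u (walk a (replicate (Suc (Suc k)) 1)) = path_bd ?w (walk a (replicate (Suc (Suc k)) 1))" for a
      unfolding path_bd_ones[OF w\<Omega>] w P by simp
    show "u (walk a (int s # replicate (Suc k) 1)) = path_bd ?w (walk a (int s # replicate (Suc k) 1))" for a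
      unfolding path_bd_s_ones[OF w\<Omega>] w Q_def[symmetric] by simp
  qed
  then show "u \<in> boundaries n S (Suc (Suc k))" using path_bd_in_boundaries[OF w\<Omega>] by simp
qed

end

section \<open>The case \<open>s \<noteq> 2\<close>: the homology of a torus\<close>

locale circulant_not_2 = circulant +
  assumes s_neq: "s \<noteq> 2"
begin

text \<open>Among three letters either two adjacent ones agree, or the letters alternate and one
  swap makes two adjacent ones agree.\<close>

lemma \<Omega>_ge_3:
  assumes "u \<in> \<Omega> (Suc (Suc (Suc k)))"
  shows "u = (\<lambda>_. 0)"
proof (rule A_eqI)
  fix a w
  assume "w \<in> words (Suc (Suc (Suc k)))"
  then obtain x y z r where w: "w = x # y # z # r"
    and xyz: "x = 1 \<or> x = int s" "y = 1 \<or> y = int s" "z = 1 \<or> z = int s"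
    by (auto simp: words_Suc)
  have "u (walk a ([] @ 1 # 1 # z # r)) = 0" "u (walk a ([] @ int s # int s # z # r)) = 0"
    "u (walk a ([x] @ 1 # 1 # r)) = 0" "u (walk a ([x] @ int s # int s # r)) = 0"
    using \<Omega>_1_1[OF assms s_neq] \<Omega>_s_s[OF assms] by blast+
  moreover have "u (walk a ([] @ 1 # int s # 1 # r)) = 0"
    using \<Omega>_swap[OF assms, of a "[]" "1 # r"] \<Omega>_1_1[OF assms s_neq, of a "[int s]" r]
    by (simp del: walk.simps)
  moreover have "u (walk a ([int s] @ 1 # int s # r)) = 0"
    using \<Omega>_swap[OF assms, of a "[int s]" r] \<Omega>_s_s[OF assms, of a "[]" "1 # r"]
    by (simp del: walk.simps)
  ultimately show "u (walk a w) = 0"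
    unfolding w using xyz by (auto simp del: walk.simps)
qed (use assms \<Omega>_subset_A zero_in_A in auto)

text \<open>The value at \<open>[1, int s]\<close> is the weight of the square with corner
  \<open>a\<close>. Each arrow is a side of two neighbouring squares, with opposite signs.\<close>

lemma path_bd_2:
  assumes "u \<in> \<Omega> (Suc (Suc 0))"
  shows "path_bd u (walk a [1]) = u (walk a [1, int s]) - u (walk (a - int s) [1, int s])"
    "path_bd u (walk a [int s]) = u (walk (a - 1) [1, int s]) - u (walk a [1, int s])"
proof -
  have z: "u (walk b [1, 1]) = 0" "u (walk b [int s, int s]) = 0"
    "u (walk b [int s, 1]) = - u (walk b [1, int s])" for b
    using \<Omega>_1_1[OF assms s_neq, of b "[]" "[]"] \<Omega>_s_s[OF assms, of b "[]" "[]"]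
      \<Omega>_swap[OF assms, of b "[]" "[]"] by (simp_all del: walk.simps)
  show "path_bd u (walk a [1]) = u (walk a [1, int s]) - u (walk (a - int s) [1, int s])"
    using path_bd_walk[OF \<Omega>_subset_A[OF assms], of "[1]" a] not_splittable_1
    by (simp add: z del: walk.simps)
  show "path_bd u (walk a [int s]) = u (walk (a - 1) [1, int s]) - u (walk a [1, int s])"
    using path_bd_walk[OF \<Omega>_subset_A[OF assms], of "[int s]" a] not_splittable_s[OF s_neq]
    by (simp add: z del: walk.simps)
qed

lemma \<Omega>_2_eqI:
  assumes "u \<in> \<Omega> (Suc (Suc 0))" "u' \<in> \<Omega> (Suc (Suc 0))"
    "\<And>a. u (walk a [1, int s]) = u' (walk a [1, int s])"
  shows "u = u'"
proof (rule \<Omega>_eqI[OF assms(1,2)])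
  fix a
  show "u (walk a (replicate (Suc (Suc 0)) 1)) = u' (walk a (replicate (Suc (Suc 0)) 1))"
    using \<Omega>_1_1[OF assms(1) s_neq, of a "[]" "[]"] \<Omega>_1_1[OF assms(2) s_neq, of a "[]" "[]"]
    by (simp del: walk.simps)
  show "u (walk a (int s # replicate (Suc 0) 1)) = u' (walk a (int s # replicate (Suc 0) 1))"
    using \<Omega>_swap[OF assms(1), of a "[]" "[]"] \<Omega>_swap[OF assms(2), of a "[]" "[]"] assms(3)[of a]
    by (simp del: walk.simps)
qed

text \<open>Weights \<open>f a\<close> on the squares
  \<open>e_{a, a+1, a+1+s} - e_{a, a+s, a+1+s}\<close>.\<close>

definition square_chain :: "(int \<Rightarrow> 'k) \<Rightarrow> 'k::field chain" where
  "square_chain f = mk_chain 2 (\<lambda>a w.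
    if w = [1, int s] then f a else if w = [int s, 1] then - f a else 0)"

lemma square_chain_walk:
  assumes "\<And>a. f (a mod int n) = f a"
  shows "square_chain f (walk a [1, int s]) = f a" "square_chain f (walk a [int s, 1]) = - f a"
    "square_chain f (walk a [1, 1]) = 0" "square_chain f (walk a [int s, int s]) = 0"
  unfolding square_chain_def using s_gt by (subst mk_chain_walk; simp add: words_2 assms)+

lemma square_chain_in_\<Omega>:
  assumes f: "\<And>a. f (a mod int n) = f a"
  shows "square_chain f \<in> \<Omega> (Suc (Suc 0))"
proof (rule \<Omega>I)
  show A: "square_chain f \<in> A (Suc (Suc 0))"
    using mk_chain_in_A unfolding square_chain_def numeral_2_eq_2 .
  fix r1 b c r2
  assume c: "\<not> int n dvd c - 1" "\<not> int n dvd c - int s"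
  let ?p = "\<lambda>t. r1 @ vtx b # vtx (b + t) # vtx (b + c) # r2"
  show "square_chain f (?p 1) + square_chain f (?p (int s)) = 0"
  proof (cases "r1 = [] \<and> r2 = []")
    case False
    then have "length (?p t) \<noteq> Suc (Suc (Suc 0))" for t by auto
    then show ?thesis using A_length[OF A] by (metis add.right_neutral)
  next
    case True
    show ?thesis
    \<comment> \<open>At the far corner of a square its two paths cancel. For any other endpoint
      each term vanishes separately, being a word \<open>1 1\<close> or \<open>s s\<close> or
      containing a non-arrow.\<close>
    proof (cases "vtx (b + c) = vtx (b + 1 + int s)")
      case eq: True
      then show ?thesis
        using square_chain_walk(1,2)[of f b, OF f] True by (simp add: add.commute add.left_commute)
    next
      case False
      have "square_chain f (?p 1) = 0"
      proof (cases "vtx (b + c) = vtx (b + 1 + 1)")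
        case eq: True
        then show ?thesis using square_chain_walk(3)[of f b, OF f] True by simp
      next
        case neq: False
        then have "\<not> arr (vtx (b + 1)) (vtx (b + c))" using False by (simp add: arr_vtx)
        then show ?thesis using A_edge[OF A, of _ _ "r1 @ [vtx b]" r2] by simp
      qed
      moreover have "square_chain f (?p (int s)) = 0"
      proof (cases "vtx (b + c) = vtx (b + int s + int s)")
        case eq: True
        then show ?thesis using square_chain_walk(4)[of f b, OF f] True by simp
      next
        case neq: False
        moreover have "b + 1 + int s = b + int s + 1" by simp
        ultimately have "\<not> arr (vtx (b + int s)) (vtx (b + c))" using False arr_vtx by metis
        then show ?thesis using A_edge[OF A, of _ _ "r1 @ [vtx b]" r2] by simp
      qed
      ultimately show ?thesis by simp
    qed
  qed
qed

text \<open>The classes are the uniform flows along each kind of arrow, detected by the total flows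
  \<open>\<phi>1\<close> and \<open>\<phi>2\<close>. Their value \<open>n\<close> on these flows is
  nonzero in characteristic 0.\<close>

lemma homology_1: "path_homology_dim TYPE('k::field_char_0) n S 1 2"
proof (rule homology_dim_2I)
  define \<phi>1 :: "'k chain \<Rightarrow> 'k" where "\<phi>1 x = (\<Sum>b<n. x (walk (int b) [1]))" for x
  define \<phi>2 :: "'k chain \<Rightarrow> 'k" where "\<phi>2 x = (\<Sum>b<n. x (walk (int b) [int s]))" for x
  have lin: "\<phi>1 (x + y) = \<phi>1 x + \<phi>1 y" "\<phi>1 (chain_scale c x) = c * \<phi>1 x"
    "\<phi>2 (x + y) = \<phi>2 x + \<phi>2 y" "\<phi>2 (chain_scale c x) = c * \<phi>2 x" for x y c
    by (simp_all add: \<phi>1_def \<phi>2_def sum.distrib sum_distrib_left del: walk.simps)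
  let ?v1 = "mk_chain 1 (\<lambda>a w. if w = [1] then 1 else 0) :: 'k chain"
  let ?v2 = "mk_chain 1 (\<lambda>a w. if w = [1] then 0 else 1) :: 'k chain"
  have v: "?v1 (walk a [1]) = 1" "?v1 (walk a [int s]) = 0"
    "?v2 (walk a [1]) = 0" "?v2 (walk a [int s]) = 1" for a
    using mk_chain_1_walk[of "\<lambda>_. 1" "\<lambda>_. 0" a] mk_chain_1_walk[of "\<lambda>_. 0" "\<lambda>_. 1" a]
    by (simp_all del: walk.simps One_nat_def)
  show "?v1 \<in> cycles n S 1" "?v2 \<in> cycles n S 1"
    unfolding cycles_1_iff by (simp_all add: v mk_chain_in_A del: walk.simps One_nat_def)
  have B: "\<phi>1 x = 0 \<and> \<phi>2 x = 0" if x: "x \<in> boundaries n S 1" for x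
  proof -
    obtain u where u: "u \<in> \<Omega> (Suc (Suc 0))" "x = path_bd u" using x by (auto simp: boundaries_def)
    show ?thesis
      using sum_shift[of "\<lambda>a. u (walk a [1, int s])" "-1"]
        sum_shift[of "\<lambda>a. u (walk a [1, int s])" "- int s"]
      by (simp add: \<phi>1_def \<phi>2_def u(2) path_bd_2[OF u(1)] sum_subtractf del: walk.simps)
  qed
  have \<phi>v: "\<phi>1 ?v1 = of_nat n" "\<phi>2 ?v1 = 0" "\<phi>2 ?v2 = of_nat n"
    by (simp_all add: \<phi>1_def \<phi>2_def v del: walk.simps One_nat_def)
  have n0: "(of_nat n :: 'k) \<noteq> 0" using n_ge by simp
  show "?v1 \<notin> chains.span (boundaries n S 1)"
    by (rule not_in_span_if_functional[where f = \<phi>1]) (use lin B \<phi>v n0 in auto)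
  show "?v2 \<notin> chains.span (insert ?v1 (boundaries n S 1))"
    by (rule not_in_span_if_functional[where f = \<phi>2]) (use lin B \<phi>v n0 in auto)
  fix u :: "'k chain"
  assume "u \<in> cycles n S 1"
  note u = cycles_1D[OF this]
  \<comment> \<open>The mean of \<open>u\<close> over the arrows of step \<open>s\<close>;
    subtracting it removes the obstruction in \<open>antidifference\<close>.\<close>
  define \<beta> where "\<beta> = \<phi>2 u / of_nat n"
  define f where "f a = u (walk a [int s]) - \<beta>" for a
  have f: "f (a mod int n) = f a" for a unfolding f_def walk_mod ..
  have sum_f: "(\<Sum>b<n. f (int b)) = 0"
    using n0 by (simp add: f_def sum_subtractf \<phi>2_def[symmetric] \<beta>_def del: walk.simps)
  obtain g where g: "\<And>a. g (a mod int n) = g a" "\<And>a. g (a - 1) - g a = f a"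
    using antidifference[of f, OF f] unfolding sum_f if_cancel diff_zero by blast
  \<comment> \<open>The step-1 part of \<open>u\<close> minus the boundary of the squares weighted
    by \<open>g\<close>; the cycle condition makes it constant.\<close>
  define h where "h a = u (walk a [1]) - g a + g (a - int s)" for a
  have "h (a - 1) = h a" for a
  proof -
    have "h (a - 1) - h a = u (walk (a - 1) [1]) - u (walk a [1]) - (g (a - 1) - g a) +
        (g (a - int s - 1) - g (a - int s))"
      by (simp add: h_def algebra_simps del: walk.simps)
    also have "\<dots> = 0"
      unfolding g f_def using u(2)[of a] by (simp add: algebra_simps del: walk.simps)
    finally show ?thesis by simp
  qed
  then have h: "h a = h 0" for a by (rule shift_invariant_const)
  let ?w = "square_chain g"
  have w\<Omega>: "?w \<in> \<Omega> (Suc (Suc 0))" by (rule square_chain_in_\<Omega>[of g, OF g(1)])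
  have w: "?w (walk a [1, int s]) = g a" for a by (rule square_chain_walk[of g, OF g(1)])
  let ?u = "\<lambda>p. u p + (- h 0 * ?v1 p + - \<beta> * ?v2 p)"
  have "path_bd ?w = ?u"
  proof (rule A_eqI)
    show "path_bd ?w \<in> A 1" using path_bd_\<Omega>(1)[OF w\<Omega>] \<Omega>_subset_A by simp
    have "(\<lambda>p. (u p + - h 0 * ?v1 p) + - \<beta> * ?v2 p) \<in> \<Omega> 1"
      by (intro \<Omega>_add_scale A_1_in_\<Omega> u mk_chain_in_A)
    then have "?u \<in> \<Omega> 1" unfolding add.assoc .
    then show "?u \<in> A 1" by (rule \<Omega>_subset_A)
    fix a x
    assume "x \<in> words 1"
    then consider "x = [1]" | "x = [int s]" unfolding words_1 by blast
    then show "path_bd ?w (walk a x) = ?u (walk a x)"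
    proof cases
      case 1
      then show ?thesis
        using h[of a] by (simp add: path_bd_2[OF w\<Omega>] w v h_def algebra_simps del: walk.simps One_nat_def)
    next
      case 2
      then show ?thesis
        using g(2)[of a] by (simp add: path_bd_2[OF w\<Omega>] w v f_def del: walk.simps One_nat_def)
    qed
  qed
  moreover have "path_bd ?w \<in> boundaries n S 1" using path_bd_in_boundaries[OF w\<Omega>] by simp
  ultimately have "?u \<in> boundaries n S 1" by simp
  then show "\<exists>c1 c2. (\<lambda>p. u p + (c1 * ?v1 p + c2 * ?v2 p)) \<in> boundaries n S 1" by blast
qed

lemma boundaries_ge_2: "boundaries n S (Suc (Suc k)) = {\<lambda>_. 0}"
proof
  show "boundaries n S (Suc (Suc k)) \<subseteq> {\<lambda>_. 0}"
    by (auto simp: boundaries_def path_bd_zero dest: \<Omega>_ge_3)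
qed (simp add: zero_in_boundaries)

text \<open>There are no nonzero boundaries, and a cycle gives adjacent squares equal weight, so it
  is a multiple of the fundamental class, the sum of all squares.\<close>

lemma homology_2: "path_homology_dim TYPE('k::field) n S 2 1"
proof (rule homology_dim_1I)
  let ?v = "square_chain (\<lambda>_. 1) :: 'k chain"
  have v: "?v (walk a [1, int s]) = 1" for a by (rule square_chain_walk) simp
  have v\<Omega>: "?v \<in> \<Omega> (Suc (Suc 0))" by (rule square_chain_in_\<Omega>) simp
  have "path_bd ?v = (\<lambda>_. 0)"
  proof (rule A_eqI)
    show "path_bd ?v \<in> A 1" using path_bd_\<Omega>(1)[OF v\<Omega>] \<Omega>_subset_A by simp
    show "path_bd ?v (walk a x) = 0" if "x \<in> words 1" for a x
      using that path_bd_2[OF v\<Omega>] unfolding words_1 by (auto simp: v simp del: walk.simps)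
  qed (rule zero_in_A)
  then show "?v \<in> cycles n S 2" using v\<Omega> by (simp add: cycles_def numeral_2_eq_2)
  have B: "boundaries n S 2 = ({\<lambda>_. 0} :: 'k chain set)"
    using boundaries_ge_2[of 0] by (simp add: numeral_2_eq_2)
  show "?v \<notin> chains.span (boundaries n S 2)"
    by (rule not_in_span_if_functional[where f = "\<lambda>x. x (walk 0 [1, int s])"])
      (auto simp: B v simp del: walk.simps)
  fix u :: "'k chain"
  assume "u \<in> cycles n S 2"
  then have u: "u \<in> \<Omega> (Suc (Suc 0))" and z: "path_bd u = (\<lambda>_. 0)"
    by (auto simp: cycles_def numeral_2_eq_2)
  define c where "c a = u (walk a [1, int s])" for a
  have "c (a - 1) = c a" for a
    using path_bd_2(2)[OF u, of a] by (simp add: z c_def del: walk.simps)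
  then have c: "c a = c 0" for a by (rule shift_invariant_const)
  have "(\<lambda>p. u p + - c 0 * ?v p) = (\<lambda>_. 0)"
  proof (rule \<Omega>_2_eqI)
    show "u (walk a [1, int s]) + - c 0 * ?v (walk a [1, int s]) = 0" for a
      using c[of a] by (simp add: v c_def del: walk.simps)
  qed (use \<Omega>_add_scale[OF u v\<Omega>] zero_in_\<Omega> in blast)+
  then show "\<exists>c. (\<lambda>p. u p + c * ?v p) \<in> boundaries n S 2" unfolding B by blast
qed

lemma homology_ge_3: "path_homology_dim TYPE('k::field) n S (Suc (Suc (Suc k))) 0"
proof (rule homology_dim_0I)
  fix u :: "'k chain"
  assume "u \<in> cycles n S (Suc (Suc (Suc k)))"
  then have "u = (\<lambda>_. 0)" using \<Omega>_ge_3 by (auto simp: cycles_def)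
  then show "u \<in> boundaries n S (Suc (Suc (Suc k)))" using zero_in_boundaries by simp
qed

end

theorem mainTheorem8:
  fixes n s :: nat
  assumes "n \<ge> 5" and "1 < s" and "2 * s < n"
  shows "(s = 2 \<longrightarrow>
            path_homology_dim TYPE('k::field_char_0) n {1, s} 0 1 \<and>
            path_homology_dim TYPE('k) n {1, s} 1 1 \<and>
            (\<forall>m\<ge>2. path_homology_dim TYPE('k) n {1, s} m 0)) \<and>
         (s \<noteq> 2 \<longrightarrow>
            path_homology_dim TYPE('k) n {1, s} 0 1 \<and>
            path_homology_dim TYPE('k) n {1, s} 1 2 \<and>
            path_homology_dim TYPE('k) n {1, s} 2 1 \<and>
            (\<forall>m\<ge>3. path_homology_dim TYPE('k) n {1, s} m 0))"
proof -
  interpret circulant n s by unfold_locales (use assms in auto)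
  have S: "{1, s} = S" by (simp add: S_def)
  show ?thesis
    unfolding S
  proof (intro conjI impI allI)
    assume "s = 2"
    then interpret circulant_2 n s by unfold_locales
    show "path_homology_dim TYPE('k) n S 0 1" by (rule homology_0)
    show "path_homology_dim TYPE('k) n S 1 1" by (rule homology_1)
    show "path_homology_dim TYPE('k) n S m 0" if "2 \<le> m" for m
    proof -
      have m: "m = Suc (Suc (m - 2))" using that by simp
      show ?thesis by (subst m) (rule homology_ge_2)
    qed
  next
    assume "s \<noteq> 2"
    then interpret circulant_not_2 n s by unfold_locales
    show "path_homology_dim TYPE('k) n S 0 1" by (rule homology_0)
    show "path_homology_dim TYPE('k) n S 1 2" by (rule homology_1)
    show "path_homology_dim TYPE('k) n S 2 1" by (rule homology_2)
    show "path_homology_dim TYPE('k) n S m 0" if "3 \<le> m" for m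
    proof -
      have m: "m = Suc (Suc (Suc (m - 3)))" using that by simp
      show ?thesis by (subst m) (rule homology_ge_3)
    qed
  qed
qed

end
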